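(* For any positive integer $k$, $$\frac{(q^2;q^2)_\infty(q^{k+1};q^{k+1})_\infty^2}{(q;q)_\infty^3(q^{2k+2};q^{2k+2})_\infty}=\sum_{\substack{m_1,\ldots,m_k\ge0\\ n_1,\ldots,n_k\ge0}}\frac{(-1)^{\sum_{i=1}^km_i}\,q^{-n_1^2+n_1+\sum_{i=1}^k(m_i^2+m_in_i+n_i^2)}\,(-1;q)_{n_1}^2}{(q;q)_{m_k}(q;q)_{m_1}(q;q)_{n_1}}\prod_{i=2}^{k}\begin{bmatrix}m_i\\ m_{i-1}\end{bmatrix}_q\prod_{i=2}^{k}\begin{bmatrix}n_{i-1}\\ n_i\end{bmatrix}_q.$$
   Context: $|q|<1$ (or $q$ is a formal variable). For $n\in\mathbb{N}\cup\{\infty\}$, $(A;q)_n:=\prod_{j=0}^{n-1}(1-Aq^j)$. The $q$-binomial coefficient is $\begin{bmatrix}N\\ M\end{bmatrix}_q:=\frac{(q;q)_N}{(q;q)_M(q;q)_{N-M}}$ if $0\le M\le N$, and $0$ otherwise. Empty products equal $1$. *)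

theory Defs
  imports "HOL-Analysis.Analysis"
begin

definition qpoch :: "complex \<Rightarrow> complex \<Rightarrow> nat \<Rightarrow> complex" where
  "qpoch A q n = (\<Prod>j<n. 1 - A * q ^ j)"

text \<open>The product converges whenever \<open>norm q < 1\<close>; only this case is meaningful.\<close>
definition qpoch_inf :: "complex \<Rightarrow> complex \<Rightarrow> complex" where
  "qpoch_inf A q = (\<Prod>j. 1 - A * q ^ j)"

definition qbinomial :: "complex \<Rightarrow> nat \<Rightarrow> nat \<Rightarrow> complex" where
  "qbinomial q N M =
     (if M \<le> N then qpoch q q N / (qpoch q q M * qpoch q q (N - M)) else 0)"

text \<open>A tuple \<open>(m\<^sub>1, \<dots>, m\<^sub>k)\<close> of natural numbers is a function that is \<open>undefined\<close>
  outside \<open>{1..k}\<close>, so that each tuple is counted exactly once.\<close>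
definition tuples :: "nat \<Rightarrow> (nat \<Rightarrow> nat) set" where
  "tuples k = {1..k} \<rightarrow>\<^sub>E UNIV"

end

theory Submission
  imports Defs
begin

text \<open>
  With \<open>m\<^sub>i - m\<^sub>i\<^sub>-\<^sub>1\<close> and \<open>n\<^sub>i\<^sub>-\<^sub>1 - n\<^sub>i\<close> as links, the sum iterates the operator with kernel
  \<open>(-1)^m q^(m^2+mn+n^2) / ((q)\<^sub>M\<^sub>-\<^sub>m (q)\<^sub>n\<^sub>-\<^sub>N)\<close>, a Dehn twist of the \<open>A\<^sub>2\<close> relativistic Toda
  chain. It commutes with two first-order difference operators, and their joint eigenfunctions are
  the products \<open>C\<^sub>j(m,n) = (-q)\<^sub>m\<^sub>-\<^sub>n \<Prod>\<^sub>i\<^sub><\<^sub>n (1+q^-i)(1-q^(j-i))(1-q^(-j-i)) / ((q)\<^sub>m (-q)\<^sub>m\<^sub>-\<^sub>j (-q)\<^sub>m\<^sub>+\<^sub>j)\<close>,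
  with eigenvalue \<open>q^(j^2)\<close>; since \<open>C\<^sub>j\<close> vanishes for \<open>n > j\<close>, all sums over \<open>n\<close> are finite.
  The first level expands as
  \<open>q^(n-n^2) (-1;q)\<^sub>n^2 / (q)\<^sub>m^2 = ((-q)\<^sub>\<infinity> / (q)\<^sub>\<infinity>)^2 \<Sum>\<^sub>j \<epsilon>\<^sub>j (-1)^j q^(j^2) C\<^sub>j(m,n)\<close>
  (\<open>\<epsilon>\<^sub>0 = 1\<close>, \<open>\<epsilon>\<^sub>j = 2\<close> otherwise). Applying the operator \<open>k\<close> times and letting \<open>M \<rightarrow> \<infinity>\<close>, \<open>N = 0\<close> leaves
  the theta series \<open>\<Sum>\<^sub>j \<epsilon>\<^sub>j (-1)^j q^((k+1)j^2)\<close>, which Gauss' identity evaluates.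
\<close>

section \<open>The Gauss sum\<close>

text \<open>Two difference operators are needed because the functions depend on two variables: the
  joint eigenvalue equations are linear in the values at \<open>(m-1,n)\<close> and
  \<open>(m,n+1)\<close>, and solving for these gives first-order recurrences, so that a joint
  eigenfunction is fixed by one value. The eigenvalue can then be read off at \<open>m = 0\<close>,
  \<open>n = j\<close>, where a single term of the operator survives.

  The obstacle is convergence: the eigenfunctions grow with \<open>j\<close> like a negative power
  of \<open>q\<close> with quadratic exponent. The factor \<open>q^(j^2)\<close> of the theta series
  and the factor \<open>q^(n^2)\<close> of the weight just outweigh this and leave a majorant that
  is a product of functions of \<open>j\<close>, \<open>m\<close> and \<open>n\<close>; it justifies
  exchanging the sum over \<open>j\<close> with the sum over tuples.

  The constant of the first-level expansion comes from the limit of large \<open>m\<close>, where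
  the eigenfunction at \<open>n = 0\<close> no longer depends on \<open>j\<close>. Gauss' identity
  is thus used twice, in base \<open>q\<close> and in base \<open>q^(k+1)\<close>.\<close>

lemma one_minus_neq_0:
  fixes z :: complex
  assumes "norm z < 1"
  shows "1 - z \<noteq> 0" "1 + z \<noteq> 0"
proof -
  have "z \<noteq> 1" "z \<noteq> - 1" using assms by auto
  thus "1 - z \<noteq> 0" "1 + z \<noteq> 0" by (auto simp: add_eq_0_iff)
qed

lemma norm_mult_power_less_1:
  fixes q :: complex
  assumes "norm q < 1"
  shows "norm (q * q ^ n) < 1"
  using power_Suc_less_one[of "norm q" n] assms
  by (cases "q = 0") (auto simp: norm_mult norm_power power_less_one_iff simp flip: power_Suc)

lemma qpoch_0 [simp]: "qpoch A q 0 = 1"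
  by (simp add: qpoch_def)

lemma qpoch_Suc: "qpoch A q (Suc n) = qpoch A q n * (1 - A * q ^ n)"
  by (simp add: qpoch_def)

lemma qpoch_self_Suc: "qpoch q q (Suc n) = qpoch q q n * (1 - q ^ Suc n)"
  by (simp add: qpoch_Suc)

lemma qpoch_neg_Suc: "qpoch (- q) q (Suc n) = qpoch (- q) q n * (1 + q ^ Suc n)"
  by (simp add: qpoch_Suc)

lemma qpoch_nz:
  assumes "norm q < 1"
  shows "qpoch q q n \<noteq> 0" "qpoch (- q) q n \<noteq> 0"
  using one_minus_neq_0[OF norm_mult_power_less_1[OF assms]] by (auto simp: qpoch_def)

lemma convergent_qpoch:
  fixes A q :: complex
  assumes "norm q < 1"
  shows "convergent_prod (\<lambda>j. 1 - A * q ^ j)"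
proof -
  have "summable (\<lambda>j. norm (1 - A * q ^ j - 1))"
    using assms by (simp add: norm_mult norm_power)
  thus ?thesis
    by (intro abs_convergent_prod_imp_convergent_prod summable_imp_abs_convergent_prod)
qed

lemma qpoch_tendsto:
  assumes "norm q < 1"
  shows "qpoch A q \<longlonglongrightarrow> qpoch_inf A q"
proof -
  have "(\<lambda>n. \<Prod>j\<le>n. 1 - A * q ^ j) \<longlonglongrightarrow> qpoch_inf A q"
    unfolding qpoch_inf_def by (rule convergent_prod_LIMSEQ[OF convergent_qpoch[OF assms]])
  hence "(\<lambda>n. qpoch A q (Suc n)) \<longlonglongrightarrow> qpoch_inf A q"
    by (simp add: qpoch_def lessThan_Suc_atMost)
  thus ?thesis by (simp add: filterlim_sequentially_Suc)
qed

lemma qpoch_inf_nz: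
  assumes "norm q < 1"
  shows "qpoch_inf q q \<noteq> 0" "qpoch_inf (- q) q \<noteq> 0"
proof -
  have "1 - q * q ^ j \<noteq> 0" "1 - (- q) * q ^ j \<noteq> 0" for j
    using one_minus_neq_0[OF norm_mult_power_less_1[OF assms, of j]] by auto
  thus "qpoch_inf q q \<noteq> 0" "qpoch_inf (- q) q \<noteq> 0"
    unfolding qpoch_inf_def by (intro prodinf_nonzero convergent_qpoch[OF assms]; blast)+
qed

lemma qpoch_bounded:
  assumes "norm q < 1"
  obtains B where "B > 0" "\<And>n. norm (qpoch A q n) \<le> B"
  using convergent_imp_Bseq[OF convergentI[OF qpoch_tendsto[OF assms]], of A] by (auto simp: Bseq_def)

lemma inverse_qpoch_bounded:
  assumes "norm q < 1" "A = q \<or> A = - q"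
  obtains B where "B > 0" "\<And>n. norm (inverse (qpoch A q n)) \<le> B"
proof -
  have "(\<lambda>n. inverse (qpoch A q n)) \<longlonglongrightarrow> inverse (qpoch_inf A q)"
    using assms qpoch_inf_nz[OF assms(1)] by (intro tendsto_inverse qpoch_tendsto) auto
  from convergent_imp_Bseq[OF convergentI[OF this]] that show thesis by (auto simp: Bseq_def)
qed

text \<open>Factor by factor this is \<open>(1 - a)(1 + a) = 1 - a^2\<close>. Applied in base
  \<open>q\<close> and in base \<open>q^(k+1)\<close>, it turns the product side of the theorem into
  quotients of Gauss type.\<close>

lemma qpoch_inf_square_base:
  assumes "norm q < 1"
  shows "qpoch_inf (q ^ 2) (q ^ 2) = qpoch_inf q q * qpoch_inf (- q) q"
proof (rule LIMSEQ_unique)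
  have "qpoch (q ^ 2) (q ^ 2) n = qpoch q q n * qpoch (- q) q n" for n
    by (induction n) (simp_all add: qpoch_Suc power2_eq_square power_mult_distrib algebra_simps)
  hence "qpoch (q ^ 2) (q ^ 2) = (\<lambda>n. qpoch q q n * qpoch (- q) q n)" by (rule ext)
  thus "qpoch (q ^ 2) (q ^ 2) \<longlonglongrightarrow> qpoch_inf q q * qpoch_inf (- q) q"
    using tendsto_mult[OF qpoch_tendsto[OF assms, of q] qpoch_tendsto[OF assms, of "- q"]] by simp
  show "qpoch (q ^ 2) (q ^ 2) \<longlonglongrightarrow> qpoch_inf (q ^ 2) (q ^ 2)"
    using assms by (intro qpoch_tendsto) (simp add: norm_power power_less_one_iff)
qed

text \<open>The factor 2 folds the bilateral series of \<open>(-1)^j q^(j^2)\<close> over all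
  integers onto \<open>j \<ge> 0\<close>.\<close>

definition theta_coeff :: "complex \<Rightarrow> nat \<Rightarrow> complex" where
  "theta_coeff q j = (if j = 0 then 1 else 2) * (- 1) ^ j * q ^ (j ^ 2)"

lemma theta_coeff_0 [simp]: "theta_coeff q 0 = 1"
  by (simp add: theta_coeff_def)

text \<open>Shanks' finite form of Gauss' identity: only the term \<open>s = 0\<close> survives as \<open>n \<rightarrow> \<infinity>\<close>.\<close>

lemma theta_partial_sum:
  fixes q :: complex
  assumes "norm q < 1"
  defines "t \<equiv> \<lambda>s. (- 1) ^ s * qpoch (- 1) q s / qpoch q q s"
  shows "(\<Sum>j\<le>n. theta_coeff q j) =
         qpoch q q n / qpoch (- q) q n * (\<Sum>s\<le>n. t s * q ^ (s * Suc n))"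
proof (induction n)
  case 0
  show ?case by (simp add: t_def)
next
  case (Suc n)
  define N where "N = Suc n"
  \<comment> \<open>A telescoping certificate in \<open>s\<close>: by \<open>tele\<close>, passing
    from \<open>n\<close> to \<open>n + 1\<close> changes each term by a difference of consecutive
    values of \<open>g\<close>. The factor \<open>1 - q^s\<close> makes \<open>g 0\<close>
    vanish.\<close>
  define g where "g = (\<lambda>s. t s * (1 - q ^ s) * q ^ (s * N))"
  have nz: "1 - q ^ Suc s \<noteq> 0" "1 + q ^ Suc s \<noteq> 0" for s
    using one_minus_neq_0[OF norm_mult_power_less_1[OF assms(1), of s]] by auto
  have t_Suc: "t (Suc s) * (1 - q ^ Suc s) = - (1 + q ^ s) * t s" for s
    using nz[of s] qpoch_nz[OF assms(1)] by (simp add: t_def qpoch_Suc field_simps)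
  have tele: "(1 - q ^ N) * (t s * q ^ (s * Suc N)) - (1 + q ^ N) * (t s * q ^ (s * N)) = g (Suc s) - g s"
    for s
  proof -
    have "g (Suc s) = - (1 + q ^ s) * t s * q ^ (s * N) * q ^ N"
      using t_Suc[of s] by (simp add: g_def power_add)
    moreover have "q ^ (s * Suc N) = q ^ s * q ^ (s * N)"
      by (simp add: power_add)
    moreover have "(1 - a) * (b * (c * d)) - (1 + a) * (b * d) = - (1 + c) * b * d * a - b * (1 - c) * d"
      for a b c d :: complex by algebra
    ultimately show ?thesis
      unfolding g_def by (simp only:)
  qed
  have f1: "(1 - q ^ N) * (\<Sum>s\<le>N. t s * q ^ (s * Suc N)) - (1 + q ^ N) * (\<Sum>s\<le>N. t s * q ^ (s * N)) = g (Suc N)"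
  proof -
    have "(\<Sum>s\<le>N. g (Suc s) - g s) = g (Suc N) - g 0"
      by (induction N) simp_all
    moreover have "g 0 = 0" by (simp add: g_def)
    ultimately show ?thesis
      unfolding sum_distrib_left sum_subtractf[symmetric] tele by simp
  qed
  have f2: "(\<Sum>s\<le>N. t s * q ^ (s * N)) = (\<Sum>s\<le>n. t s * q ^ (s * N)) + t N * q ^ (N * N)"
    by (simp add: N_def)
  have f3: "g (Suc N) = - (1 + q ^ N) * t N * q ^ (N * N) * q ^ N"
    using t_Suc[of N] by (simp add: g_def power_add)
  have *: "(1 - q ^ N) * (\<Sum>s\<le>N. t s * q ^ (s * Suc N)) =
      (1 + q ^ N) * (\<Sum>s\<le>n. t s * q ^ (s * N)) + (1 + q ^ N) * (1 - q ^ N) * t N * q ^ (N * N)"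
  proof -
    have "X = (1 + a) * Y + (1 + a) * (1 - a) * b * c"
      if "X - (1 + a) * Z = G" "Z = Y + b * c" "G = - (1 + a) * b * c * a" for a b c G X Y Z :: complex
    proof -
      have "X = G + (1 + a) * Z" using that(1) by (simp add: diff_eq_eq)
      thus ?thesis unfolding that(2,3) by (simp add: algebra_simps)
    qed
    from this[OF f1 f2 f3] show ?thesis .
  qed
  \<comment> \<open>The surplus left by the telescoping is the next theta coefficient; its factor 2
    is the first factor of \<open>(-1;q)\<close>.\<close>
  have "qpoch (- 1) q (Suc n) = 2 * qpoch (- q) q n"
    unfolding qpoch_def by (subst prod.lessThan_Suc_shift) simp
  hence t_N: "qpoch q q n / qpoch (- q) q n * ((1 - q ^ N) * t N * q ^ (N * N)) = theta_coeff q N"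
    using nz[of n] qpoch_nz[OF assms(1)]
    by (simp add: t_def N_def theta_coeff_def qpoch_self_Suc power2_eq_square field_simps del: power_Suc)
  have "qpoch q q N / qpoch (- q) q N * (\<Sum>s\<le>N. t s * q ^ (s * Suc N)) =
        qpoch q q n / qpoch (- q) q n / (1 + q ^ N) * ((1 - q ^ N) * (\<Sum>s\<le>N. t s * q ^ (s * Suc N)))"
    unfolding N_def qpoch_self_Suc qpoch_neg_Suc by simp
  also have "\<dots> = qpoch q q n / qpoch (- q) q n * (\<Sum>s\<le>n. t s * q ^ (s * N)) + theta_coeff q N"
  proof -
    have "x / c * (c * S + c * d * b * Q) = x * S + x * (d * b * Q)" if "c \<noteq> 0" for x b c d S Q :: complex
      using that by (simp add: field_simps)
    from this[OF nz(2)[of n]] show ?thesis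
      unfolding * t_N[symmetric] by (simp only: N_def)
  qed
  finally show ?case
    using Suc.IH by (simp add: N_def)
qed

theorem gauss_theta_sums:
  assumes "norm q < 1"
  shows "theta_coeff q sums (qpoch_inf q q / qpoch_inf (- q) q)"
proof -
  define t where "t = (\<lambda>s. (- 1) ^ s * qpoch (- 1) q s / qpoch q q s)"
  obtain B1 where B1: "B1 > 0" "\<And>n. norm (qpoch (- 1) q n) \<le> B1"
    using qpoch_bounded[OF assms] by blast
  obtain B2 where B2: "B2 > 0" "\<And>n. norm (inverse (qpoch q q n)) \<le> B2"
    using inverse_qpoch_bounded[OF assms, of q] by blast
  have t_le: "norm (t s) \<le> B1 * B2" for s
    unfolding t_def divide_inverse using B1 B2 by (auto simp: norm_mult norm_power intro!: mult_mono)
  \<comment> \<open>The terms with \<open>s \<ge> 1\<close>. As \<open>s * (n + 1) \<ge> n\<close>,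
    each is at most a constant times \<open>norm q ^ n\<close>, and there are only \<open>n\<close>
    of them.\<close>
  define R where "R = (\<lambda>n. \<Sum>s\<in>{1..n}. t s * q ^ (s * Suc n))"
  have "R \<longlonglongrightarrow> 0"
  proof (rule Lim_null_comparison)
    show "\<forall>\<^sub>F n in sequentially. norm (R n) \<le> B1 * B2 * (of_nat n * norm q ^ n)"
    proof (rule always_eventually, rule allI)
      fix n
      have "norm (R n) \<le> (\<Sum>s\<in>{1..n}. B1 * B2 * norm q ^ n)"
        unfolding R_def
      proof (rule sum_norm_le)
        fix s assume "s \<in> {1..n}"
        hence "n \<le> s * Suc n" by (cases s) auto
        thus "norm (t s * q ^ (s * Suc n)) \<le> B1 * B2 * norm q ^ n"
          unfolding norm_mult norm_power using t_le B1 B2 assms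
          by (intro mult_mono power_decreasing) auto
      qed
      thus "norm (R n) \<le> B1 * B2 * (of_nat n * norm q ^ n)"
        by (simp add: algebra_simps)
    qed
    show "(\<lambda>n. B1 * B2 * (of_nat n * norm q ^ n)) \<longlonglongrightarrow> 0"
      using powser_times_n_limit_0[of "norm q"] assms by (intro tendsto_mult_right_zero) simp
  qed
  hence "(\<lambda>n. qpoch q q n / qpoch (- q) q n * (1 + R n)) \<longlonglongrightarrow>
         qpoch_inf q q / qpoch_inf (- q) q * (1 + 0)"
    using assms qpoch_inf_nz[OF assms] by (intro tendsto_intros qpoch_tendsto) auto
  moreover have "(\<Sum>s\<le>n. t s * q ^ (s * Suc n)) = 1 + R n" for n
    unfolding R_def by (simp add: sum.atMost_shift atLeast0AtMost[symmetric] sum.atLeast_Suc_atMost t_def)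
  ultimately have "(\<lambda>n. \<Sum>j\<le>n. theta_coeff q j) \<longlonglongrightarrow> qpoch_inf q q / qpoch_inf (- q) q"
    using theta_partial_sum[OF assms] by (simp add: t_def)
  thus ?thesis by (simp add: sums_def_le)
qed

section \<open>The kernel and the transfer operator\<close>

text \<open>\<open>q = 0\<close> is excluded because the kernel contains negative powers of
  \<open>q\<close>; that case of the theorem is \<open>summand_has_sum_0\<close>.\<close>

locale q_nome =
  fixes q :: complex
  assumes norm_q: "norm q < 1" and q_nz [simp]: "q \<noteq> 0"
begin

text \<open>The symbol \<open>(-q;q)\<^sub>z\<close>, continued to negative \<open>z\<close> so that \<open>(-q;q)\<^sub>z = (-q;q)\<^sub>z\<^sub>-\<^sub>1 (1 + q^z)\<close> holds throughout.\<close>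

definition sgn_poch :: "int \<Rightarrow> complex" where
  "sgn_poch z = (if z \<ge> 0 then qpoch (- q) q (nat z) else inverse (\<Prod>i<nat (- z). 1 + 1 / q ^ i))"

text \<open>The value 0 at negative arguments is the continuation demanded by
  \<open>recip_poch_rec\<close>. It encodes the constraints \<open>m \<le> M\<close> and
  \<open>N \<le> n\<close> of a link, so that summation ranges need not mention them.\<close>

definition recip_poch :: "int \<Rightarrow> complex" where
  "recip_poch z = (if z \<ge> 0 then inverse (qpoch q q (nat z)) else 0)"

definition ker_n :: "nat \<Rightarrow> nat \<Rightarrow> complex" where
  "ker_n j n = (\<Prod>i<n. (1 + 1 / q ^ i) * (1 - q ^ j / q ^ i) * (1 - 1 / (q ^ j * q ^ i)))"

text \<open>This is \<open>C\<^sub>j(m,n)\<close> of the overview.\<close>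

definition ker :: "nat \<Rightarrow> nat \<Rightarrow> nat \<Rightarrow> complex" where
  "ker j m n = sgn_poch (int m - int n) * ker_n j n /
     (qpoch q q m * sgn_poch (int m - int j) * sgn_poch (int m + int j))"

definition gauss :: "nat \<Rightarrow> nat \<Rightarrow> complex" where
  "gauss m n = (- 1) ^ m * q ^ (m\<^sup>2 + m * n + n\<^sup>2)"

lemma one_minus_power_nz: "n > 0 \<Longrightarrow> 1 - q ^ n \<noteq> 0"
  using norm_q by (intro one_minus_neq_0) (simp add: norm_power power_less_one_iff)

lemma one_plus_power_nz: "1 + q ^ n \<noteq> 0"
proof (cases "n = 0")
  case False
  thus ?thesis using norm_q by (intro one_minus_neq_0) (simp add: norm_power power_less_one_iff)
qed simp

lemma one_plus_inverse_power_nz: "1 + 1 / q ^ n \<noteq> 0"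
  using one_plus_power_nz[of n] by (simp add: field_simps add.commute)

lemma one_plus_powi_nz: "1 + q powi z \<noteq> 0"
  using one_plus_power_nz[of "nat z"] one_plus_inverse_power_nz[of "nat (- z)"]
  by (cases "z \<ge> 0") (simp_all add: power_int_def divide_inverse power_inverse)

lemma one_plus_power_div_nz: "1 + q ^ m / q ^ n \<noteq> 0"
  using one_plus_powi_nz[of "int m - int n"] by (simp add: power_int_diff)

lemma one_plus_power_mult_nz: "1 + q ^ m * q ^ n \<noteq> 0"
  using one_plus_power_nz[of "m + n"] by (simp add: power_add)

section \<open>Recurrences of the kernel in \<open>m\<close> and \<open>n\<close>\<close>

lemma sgn_poch_rec: "sgn_poch z = sgn_poch (z - 1) * (1 + q powi z)"
proof -
  consider n where "z = int (Suc n)" | "z = 0" | n where "z = - int (Suc n)"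
    by (metis int_cases3 not0_implies_Suc of_nat_0_less_iff less_numeral_extra(3))
  thus ?thesis
  proof cases
    case 1
    have "nat (int (Suc n)) = Suc n" "nat (int (Suc n) - 1) = n" by auto
    thus ?thesis using 1 by (simp add: sgn_poch_def qpoch_neg_Suc del: of_nat_Suc)
  next
    case 2
    thus ?thesis by (simp add: sgn_poch_def)
  next
    case 3
    have "nat (- z) = Suc n" "nat (- (z - 1)) = Suc (Suc n)" "z < 0" using 3 by auto
    moreover have "q powi z = 1 / q ^ Suc n"
      unfolding 3 power_int_minus by (simp add: divide_inverse power_int_add del: of_nat_Suc flip: power_Suc)
    ultimately show ?thesis
      using one_plus_inverse_power_nz[of "Suc n"]
      by (simp add: sgn_poch_def del: power_Suc)
  qed
qed

lemma sgn_poch_nz [simp]: "sgn_poch z \<noteq> 0"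
  using qpoch_nz(2)[OF norm_q] one_plus_inverse_power_nz by (simp add: sgn_poch_def)

lemma recip_poch_rec: "recip_poch (z - 1) = (1 - q powi z) * recip_poch z"
proof -
  consider n where "z = int (Suc n)" | "z = 0" | "z < 0"
    by (metis gr0_conv_Suc less_linear pos_int_cases)
  thus ?thesis
  proof cases
    case 1
    have "nat (int (Suc n)) = Suc n" "nat (int (Suc n) - 1) = n" by auto
    thus ?thesis using 1 one_minus_power_nz[of "Suc n"]
      by (simp add: recip_poch_def qpoch_self_Suc mult.left_commute[of "1 - q ^ Suc n"]
          del: of_nat_Suc power_Suc)
  qed (auto simp: recip_poch_def)
qed

lemma recip_poch_0 [simp]: "recip_poch 0 = 1"
  and recip_poch_neg [simp]: "z < 0 \<Longrightarrow> recip_poch z = 0"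
  and recip_poch_of_nat: "recip_poch (int n) = inverse (qpoch q q n)"
  by (simp_all add: recip_poch_def)

lemma ker_n_0 [simp]: "ker_n j 0 = 1"
  and ker_n_Suc: "ker_n j (Suc n) = ker_n j n * ((1 + 1 / q ^ n) * (1 - q ^ j / q ^ n) * (1 - 1 / (q ^ j * q ^ n)))"
  by (simp_all add: ker_n_def)

lemma ker_n_eq_0: "j < n \<Longrightarrow> ker_n j n = 0"
  by (auto simp: ker_n_def)

lemma ker_eq_0: "j < n \<Longrightarrow> ker j m n = 0"
  by (simp add: ker_def ker_n_eq_0)

lemma ker_rec_m:
  "ker j (Suc m) n * ((1 - q ^ Suc m) * (1 + q ^ Suc m * q ^ j) * (1 + q ^ Suc m / q ^ j)) =
   ker j m n * (1 + q ^ Suc m / q ^ n)"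
proof -
  have "sgn_poch (int (Suc m) - int i) = sgn_poch (int m - int i) * (1 + q ^ Suc m / q ^ i)" for i
    using sgn_poch_rec[of "int (Suc m) - int i"] by (simp add: power_int_diff power_int_add)
  moreover have "sgn_poch (int (Suc m) + int j) = sgn_poch (int m + int j) * (1 + q ^ Suc m * q ^ j)"
    using sgn_poch_rec[of "int (Suc m) + int j"] by (simp add: power_int_add)
  ultimately show ?thesis
    using qpoch_nz(1)[OF norm_q] one_plus_power_div_nz[of "Suc m" j] one_plus_power_mult_nz[of "Suc m" j]
      one_minus_power_nz[of "Suc m"]
    unfolding ker_def by (simp add: qpoch_self_Suc mult_ac del: of_nat_Suc power_Suc)
qed

lemma ker_rec_n:
  "ker j m (Suc n) * (1 + q ^ m / q ^ n) =
   ker j m n * ((1 + 1 / q ^ n) * (1 - q ^ j / q ^ n) * (1 - 1 / (q ^ j * q ^ n)))"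
proof -
  have "sgn_poch (int m - int n) = sgn_poch (int m - int (Suc n)) * (1 + q ^ m / q ^ n)"
    using sgn_poch_rec[of "int m - int n"] by (simp add: power_int_diff algebra_simps)
  thus ?thesis
    by (simp add: ker_def ker_n_Suc mult_ac)
qed

text \<open>None of the three factors in \<open>ker_rec_n\<close> vanishes while
  \<open>n < j\<close>. The proof of \<open>ker_eigen\<close> divides by them.\<close>

lemma ker_nz: "n \<le> j \<Longrightarrow> ker j m n \<noteq> 0"
proof (induction n)
  case 0
  thus ?case by (simp add: ker_def qpoch_nz[OF norm_q])
next
  case (Suc n)
  have "q ^ j \<noteq> q ^ n"
    using Suc.prems one_minus_power_nz[of "j - n"] by (auto simp: power_diff)
  moreover have "q ^ j * q ^ n \<noteq> 1"
    using Suc.prems one_minus_power_nz[of "j + n"] by (simp add: power_add)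
  ultimately show ?case
    using Suc ker_rec_n[of j m n] one_plus_inverse_power_nz[of n] by force
qed

text \<open>One level cut off to a finite box; nothing is lost if \<open>M \<le> P\<close> and
  \<open>f\<close> vanishes for \<open>n > J\<close>. Integer arguments let the difference operators
  step from \<open>M = 0\<close> to \<open>-1\<close>.\<close>

definition transfer :: "nat \<Rightarrow> nat \<Rightarrow> (nat \<Rightarrow> nat \<Rightarrow> complex) \<Rightarrow> int \<Rightarrow> int \<Rightarrow> complex" where
  "transfer P J f M N = (\<Sum>m\<le>P. \<Sum>n\<le>J. recip_poch (M - int m) * recip_poch (int n - N) * f m n)"

section \<open>Moving operators on \<open>(M,N)\<close> under the transfer sum\<close>

lemma recip_poch_diff: "recip_poch z - recip_poch (z - 1) = q powi z * recip_poch z"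
  by (simp add: recip_poch_rec algebra_simps)

lemma transfer_add: "transfer P J (\<lambda>m n. f m n + g m n) M N = transfer P J f M N + transfer P J g M N"
  and transfer_diff: "transfer P J (\<lambda>m n. f m n - g m n) M N = transfer P J f M N - transfer P J g M N"
  and transfer_scale: "transfer P J (\<lambda>m n. c * f m n) M N = c * transfer P J f M N"
  by (simp_all add: transfer_def algebra_simps sum.distrib sum_subtractf sum_distrib_left)

text \<open>Differencing a link reproduces it times a power of \<open>q\<close>, by
  \<open>recip_poch_diff\<close>; hence a shift of \<open>M\<close> outside becomes a multiplication
  inside.\<close>

lemma transfer_lower_m:
  "q powi (- M) * (transfer P J f M N - transfer P J f (M - 1) N) = transfer P J (\<lambda>m n. f m n / q ^ m) M N"
proof -
  have "q powi (- M) * (recip_poch (M - int m) - recip_poch (M - 1 - int m)) =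
        recip_poch (M - int m) / q ^ m" for m
  proof -
    have "M - 1 - int m = M - int m - 1" by simp
    hence "recip_poch (M - int m) - recip_poch (M - 1 - int m) = q powi (M - int m) * recip_poch (M - int m)"
      by (simp only: recip_poch_diff)
    thus ?thesis by (simp add: power_int_diff power_int_minus)
  qed
  hence "q powi (- M) * (recip_poch (M - int m) * c - recip_poch (M - 1 - int m) * c) =
        recip_poch (M - int m) * c / q ^ m" for m c
    by (metis left_diff_distrib mult.assoc times_divide_eq_left)
  note * = this[of _ "recip_poch _ * f _ _"]
  show ?thesis
    unfolding transfer_def sum_subtractf[symmetric] sum_distrib_left mult.assoc *
    by simp
qed

lemma transfer_upper_n:
  "q powi N * (transfer P J f M N - transfer P J f M (N + 1)) = transfer P J (\<lambda>m n. q ^ n * f m n) M N"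
proof -
  have "q powi N * (recip_poch (int n - N) - recip_poch (int n - (N + 1))) =
        recip_poch (int n - N) * q ^ n" for n
  proof -
    have "int n - (N + 1) = int n - N - 1" by simp
    hence "recip_poch (int n - N) - recip_poch (int n - (N + 1)) = q powi (int n - N) * recip_poch (int n - N)"
      by (simp only: recip_poch_diff)
    thus ?thesis by (simp add: power_int_diff)
  qed
  hence "q powi N * (a * recip_poch (int n - N) * b - a * recip_poch (int n - (N + 1)) * b) =
        a * recip_poch (int n - N) * (q ^ n * b)" for n a b
    by (metis (no_types, lifting) left_diff_distrib right_diff_distrib mult.assoc mult.left_commute)
  thus ?thesis
    unfolding transfer_def sum_subtractf[symmetric] sum_distrib_left by simp
qed

text \<open>Conversely, a multiplication outside becomes a shift inside: \<open>q^M\<close> is split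
  as \<open>q^m q^(M-m)\<close>, the second factor turns the link into a difference, and the shifted
  half is reindexed by \<open>m + 1\<close>. \<open>M \<le> P\<close> kills the boundary term at
  \<open>m = P + 1\<close>.\<close>

lemma transfer_mult_m:
  assumes "M \<le> int P"
  shows "q powi M * transfer P J f M N =
         transfer P J (\<lambda>m n. q ^ m * f m n - (if m = 0 then 0 else q ^ (m - 1) * f (m - 1) n)) M N"
proof -
  have shift: "(\<Sum>m\<le>P. recip_poch (M - 1 - int m) * h m) =
        (\<Sum>m\<le>P. recip_poch (M - int m) * (if m = 0 then 0 else h (m - 1)))" for h
  proof -
    have "(\<Sum>m\<le>Suc P. recip_poch (M - int m) * (if m = 0 then 0 else h (m - 1))) =
          (\<Sum>m\<le>P. recip_poch (M - 1 - int m) * h m)"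
      by (subst sum.atMost_Suc_shift) (simp add: algebra_simps)
    thus ?thesis using assms by simp
  qed
  have 1: "q powi M * recip_poch (M - int m) = q ^ m * (recip_poch (M - int m) - recip_poch (M - 1 - int m))" for m
  proof -
    have "M - 1 - int m = M - int m - 1" by simp
    hence "recip_poch (M - int m) - recip_poch (M - 1 - int m) = q powi (M - int m) * recip_poch (M - int m)"
      by (simp only: recip_poch_diff)
    thus ?thesis by (simp add: power_int_diff)
  qed
  define F where "F = (\<lambda>m. \<Sum>n\<le>J. recip_poch (int n - N) * f m n)"
  have tw: "transfer P J g M N = (\<Sum>m\<le>P. recip_poch (M - int m) * (\<Sum>n\<le>J. recip_poch (int n - N) * g m n))" for g
    by (simp add: transfer_def sum_distrib_left mult.assoc)
  have "q powi M * transfer P J f M N = (\<Sum>m\<le>P. q powi M * recip_poch (M - int m) * F m)"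
    unfolding tw F_def sum_distrib_left[of "q powi M"] by (simp add: mult.assoc)
  also have "\<dots> = (\<Sum>m\<le>P. recip_poch (M - int m) * (q ^ m * F m)) -
                  (\<Sum>m\<le>P. recip_poch (M - 1 - int m) * (q ^ m * F m))"
    unfolding 1 sum_subtractf[symmetric] by (simp add: algebra_simps)
  also have "\<dots> = (\<Sum>m\<le>P. recip_poch (M - int m) * (q ^ m * F m - (if m = 0 then 0 else q ^ (m - 1) * F (m - 1))))"
    unfolding shift sum_subtractf[symmetric] by (simp add: right_diff_distrib)
  also have "\<dots> = transfer P J (\<lambda>m n. q ^ m * f m n - (if m = 0 then 0 else q ^ (m - 1) * f (m - 1) n)) M N"
    unfolding tw F_def by (intro sum.cong refl arg_cong2[of _ _ _ _ "(*)"])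
      (simp add: right_diff_distrib sum_subtractf sum_distrib_left mult_ac)
  finally show ?thesis .
qed

text \<open>The mirror image of \<open>transfer_mult_m\<close>. \<open>N \<ge> 0\<close> removes the
  boundary term at \<open>n = 0\<close>, the vanishing of \<open>f\<close> at \<open>Suc J\<close>
  the one at the top.\<close>

lemma transfer_div_n:
  assumes "N \<ge> 0" "\<And>m. f m (Suc J) = 0"
  shows "q powi (- N) * transfer P J f M N =
         transfer P J (\<lambda>m n. f m n / q ^ n - f m (Suc n) / q ^ Suc n) M N"
proof -
  have shift: "(\<Sum>n\<le>J. recip_poch (int n - N - 1) * h n) = (\<Sum>n\<le>J. recip_poch (int n - N) * h (Suc n))"
    if "h (Suc J) = 0" for h
  proof -
    have "(\<Sum>n\<le>Suc J. recip_poch (int n - N - 1) * h n) = (\<Sum>n\<le>J. recip_poch (int n - N) * h (Suc n))"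
      using assms(1) by (subst sum.atMost_Suc_shift) (simp add: algebra_simps)
    thus ?thesis using that by simp
  qed
  have 1: "q powi (- N) * recip_poch (int n - N) = (recip_poch (int n - N) - recip_poch (int n - N - 1)) / q ^ n" for n
    unfolding recip_poch_diff by (simp add: power_int_diff power_int_minus divide_inverse)
  have "q powi (- N) * (\<Sum>n\<le>J. recip_poch (int n - N) * f m n) =
        (\<Sum>n\<le>J. recip_poch (int n - N) * (f m n / q ^ n - f m (Suc n) / q ^ Suc n))" for m
  proof -
    have "q powi (- N) * (\<Sum>n\<le>J. recip_poch (int n - N) * f m n) =
          (\<Sum>n\<le>J. (q powi (- N) * recip_poch (int n - N)) * f m n)"
      by (simp only: sum_distrib_left mult.assoc)
    also have "\<dots> = (\<Sum>n\<le>J. recip_poch (int n - N) * (f m n / q ^ n)) -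
                    (\<Sum>n\<le>J. recip_poch (int n - N - 1) * (f m n / q ^ n))"
      unfolding 1 sum_subtractf[symmetric] by (simp add: algebra_simps diff_divide_distrib)
    also have "\<dots> = (\<Sum>n\<le>J. recip_poch (int n - N) * (f m n / q ^ n - f m (Suc n) / q ^ Suc n))"
      using assms(2) by (subst shift) (simp_all only: sum_subtractf[symmetric] right_diff_distrib, simp)
    finally show ?thesis .
  qed
  note * = this
  have tw: "transfer P J g M N = (\<Sum>m\<le>P. recip_poch (M - int m) * (\<Sum>n\<le>J. recip_poch (int n - N) * g m n))" for g
    by (simp add: transfer_def sum_distrib_left mult.assoc)
  show ?thesis
    unfolding tw
    by (subst sum_distrib_left, intro sum.cong refl, subst *[symmetric], rule mult.left_commute)
qed

section \<open>The kernel as an eigenfunction\<close>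

text \<open>The value 0 at \<open>m = 0\<close> agrees with the recurrence, whose factor
  \<open>1 - q^m\<close> vanishes there; so \<open>ker_pred_eq\<close> needs no restriction on
  \<open>m\<close>.\<close>

definition ker_pred :: "nat \<Rightarrow> nat \<Rightarrow> nat \<Rightarrow> complex" where
  "ker_pred j m n = (if m = 0 then 0 else ker j (m - 1) n)"

lemma ker_pred_eq:
  "ker_pred j m n * (1 + q ^ m / q ^ n) =
   ker j m n * ((1 - q ^ m) * (1 + q ^ m * q ^ j) * (1 + q ^ m / q ^ j))"
  using ker_rec_m[of j "m - 1" n] by (cases m) (simp_all add: ker_pred_def del: power_Suc)

text \<open>
  The values \<open>c\<close>, \<open>cm\<close>, \<open>cn\<close> are those at \<open>(m,n)\<close>, \<open>(m-1,n)\<close>, \<open>(m,n+1)\<close>, with \<open>x = q^m\<close>, \<open>y = q^n\<close>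
  and \<open>w = q^j\<close>. The conclusions are eigenvalue equations for two difference operators that do not
  depend on \<open>j\<close>; the transfer operator commutes with these.
\<close>

lemma toda_hamiltonians:
  fixes x y w c cm cn :: complex
  assumes "x \<noteq> 0" "y \<noteq> 0" "w \<noteq> 0" "1 + x / y \<noteq> 0"
    and cm: "cm * (1 + x / y) = c * ((1 - x) * (1 + x * w) * (1 + x / w))"
    and cn: "cn * (1 + x / y) = c * ((1 + 1 / y) * (1 - w / y) * (1 - 1 / (w * y)))"
  shows "c / x - cm / x - x * y * (c - cn) - c / y = (1 - w - 1 / w) * c"
    and "y * (c - cn) + (c - cm) / (x * y) - x * c = - (1 - w - 1 / w) * c"
proof -
  have xy: "x + y \<noteq> 0" using assms by (simp add: field_simps)
  have "cm = c * ((1 - x) * (1 + x * w) * (1 + x / w)) / (1 + x / y)"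
    using cm assms(4) by (simp add: eq_divide_eq)
  hence cm': "cm = c * (1 - x) * (1 + x * w) * (x + w) * y / (w * (x + y))"
    using assms(1-3) xy by (simp add: field_simps)
  have "cn = c * ((1 + 1 / y) * (1 - w / y) * (1 - 1 / (w * y))) / (1 + x / y)"
    using cn assms(4) by (simp add: eq_divide_eq)
  hence cn': "cn = c * (y + 1) * (y - w) * (w * y - 1) / (w * y ^ 2 * (x + y))"
  proof -
    have "1 + x / y = (x + y) / y" using assms(2) by (simp add: field_simps)
    moreover have "(1 + 1 / y) * (1 - w / y) * (1 - 1 / (w * y)) = (y + 1) * (y - w) * (w * y - 1) / (w * y ^ 3)"
      using assms(2,3) by (simp add: field_simps power3_eq_cube)
    ultimately show ?thesis
      using \<open>cn = _ / _\<close> assms(2) by (simp add: power3_eq_cube power2_eq_square)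
  qed
  show "c / x - cm / x - x * y * (c - cn) - c / y = (1 - w - 1 / w) * c"
    unfolding cm' cn' using assms(1-3) xy by (simp add: divide_simps) algebra
  show "y * (c - cn) + (c - cm) / (x * y) - x * c = - (1 - w - 1 / w) * c"
    unfolding cm' cn' using assms(1-3) xy by (simp add: divide_simps) algebra
qed

text \<open>The two equations are linear in \<open>dm\<close> and \<open>dn\<close>. One combination
  eliminates \<open>dn\<close>, the other \<open>dm\<close>, and what remains are the recurrences of
  the kernel: a joint eigenfunction is determined by a single value.\<close>

lemma toda_hamiltonians_converse:
  fixes x y w d dm dn :: complex
  assumes "x \<noteq> 0" "y \<noteq> 0" "w \<noteq> 0"
    and 1: "(d - dm) / x - x * y * (d - dn) - d / y = (1 - w - 1 / w) * d"
    and 2: "y * (d - dn) + (d - dm) / (x * y) - x * d = - (1 - w - 1 / w) * d"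
  shows "dm * (1 + x / y) = d * ((1 - x) * (1 + x * w) * (1 + x / w))"
    and "dn * (1 + x / y) = d * ((1 + 1 / y) * (1 - w / y) * (1 - 1 / (w * y)))"
proof -
  have h1: "(d - dm) / x - x * y * (d - dn) - d / y - (1 - w - 1 / w) * d = 0"
    unfolding 1 by simp
  have h2: "y * (d - dn) + (d - dm) / (x * y) - x * d + (1 - w - 1 / w) * d = 0"
    unfolding 2 by (simp only: mult_minus_left add.left_inverse)
  have "dm * (1 + x / y) - d * ((1 - x) * (1 + x * w) * (1 + x / w)) =
        - x * ((d - dm) / x - x * y * (d - dn) - d / y - (1 - w - 1 / w) * d)
        - x * x * (y * (d - dn) + (d - dm) / (x * y) - x * d + (1 - w - 1 / w) * d)"
    using assms(1-3) by (simp add: divide_simps) algebra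
  thus "dm * (1 + x / y) = d * ((1 - x) * (1 + x * w) * (1 + x / w))"
    by (simp only: h1 h2 mult_zero_right diff_0_right right_minus_eq)
  have "dn * (1 + x / y) - d * ((1 + 1 / y) * (1 - w / y) * (1 - 1 / (w * y))) =
        1 / y * (1 / y * ((d - dm) / x - x * y * (d - dn) - d / y - (1 - w - 1 / w) * d)
        - (y * (d - dn) + (d - dm) / (x * y) - x * d + (1 - w - 1 / w) * d))"
    using assms(1-3) by (simp add: divide_simps) algebra
  thus "dn * (1 + x / y) = d * ((1 + 1 / y) * (1 - w / y) * (1 - 1 / (w * y)))"
    by (simp only: h1 h2 mult_zero_right diff_0_right right_minus_eq)
qed

lemma gauss_Suc_left: "gauss (Suc m) n = - gauss m n * (q ^ m * q ^ m * q * q ^ n)"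
  and gauss_Suc_right: "gauss m (Suc n) = gauss m n * (q ^ m * q ^ n * q ^ n * q)"
  by (simp_all add: gauss_def power2_eq_square power_add)

text \<open>The transferred function satisfies both eigenvalue equations of the kernel, hence by
  \<open>toda_hamiltonians_converse\<close> the same first-order recurrences. So it is a multiple of
  the kernel, and comparing one value gives the factor.\<close>

lemma ker_eigen:
  assumes "M \<le> P" "N \<le> j"
  shows "transfer P j (\<lambda>m n. gauss m n * ker j m n) (int M) (int N) = q ^ (j\<^sup>2) * ker j M N"
proof -
  define f where "f = (\<lambda>m n. gauss m n * ker j m n)"
  define w where "w = q ^ j"
  define e where "e = 1 - w - 1 / w"
  have [simp]: "w \<noteq> 0" by (simp add: w_def)
  have f0: "f m (Suc j) = 0" for m by (simp add: f_def ker_eq_0)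
  let ?D = "transfer P j f"
  have ham: "ker j m n / q ^ m - ker_pred j m n / q ^ m
        - q ^ m * q ^ n * (ker j m n - ker j m (Suc n)) - ker j m n / q ^ n = e * ker j m n"
    "q ^ n * (ker j m n - ker j m (Suc n)) + (ker j m n - ker_pred j m n) / (q ^ m * q ^ n)
        - q ^ m * ker j m n = - e * ker j m n" for m n
    using toda_hamiltonians[OF _ _ _ one_plus_power_div_nz ker_pred_eq ker_rec_n, of m n j]
    by (simp_all add: e_def w_def)
  \<comment> \<open>The quadratic exponent of \<open>gauss\<close> is tuned so that the shifted
    terms become terms of the two operators, with the weight at \<open>(m,n)\<close> as a common
    factor.\<close>
  have left: "(if m = 0 then 0 else q ^ (m - 1) * (q ^ n * f (m - 1) n)) = - gauss m n * ker_pred j m n / q ^ m" for m n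
    by (cases m) (simp_all add: f_def ker_pred_def gauss_Suc_left field_simps)
  have left': "(if m = 0 then 0 else q ^ (m - 1) * f (m - 1) n) =
      - gauss m n * ker_pred j m n / (q ^ m * q ^ n)" for m n
    by (cases m) (simp_all add: f_def ker_pred_def gauss_Suc_left field_simps)
  have right: "f m (Suc n) / q ^ Suc n = gauss m n * q ^ m * q ^ n * ker j m (Suc n)" for m n
    by (simp add: f_def gauss_Suc_right field_simps)
  \<comment> \<open>Under the sum the terms change roles, shifts outside giving multiplications
    inside and conversely, yet the resulting operator is again the one in
    \<open>ham\<close>.\<close>
  have E1: "(?D M N - ?D (M - 1) N) / q powi M - q powi M * q powi N * (?D M N - ?D M (N + 1)) - ?D M N / q powi N
      = e * ?D M N"
    if "M \<le> int P" "N \<ge> 0" for M N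
  proof -
    have "(?D M N - ?D (M - 1) N) / q powi M - q powi M * q powi N * (?D M N - ?D M (N + 1)) - ?D M N / q powi N =
      q powi (- M) * (?D M N - ?D (M - 1) N) - q powi M * (q powi N * (?D M N - ?D M (N + 1))) - q powi (- N) * ?D M N"
      by (simp add: power_int_minus divide_inverse mult_ac)
    also have "\<dots> = transfer P j (\<lambda>m n. f m n / q ^ m
        - (q ^ m * (q ^ n * f m n) - (if m = 0 then 0 else q ^ (m - 1) * (q ^ n * f (m - 1) n)))
        - (f m n / q ^ n - f m (Suc n) / q ^ Suc n)) M N"
      unfolding transfer_lower_m transfer_upper_n transfer_mult_m[OF that(1)] transfer_div_n[where f = f and J = j, OF that(2) f0] transfer_diff ..
    also have "\<dots> = transfer P j (\<lambda>m n. e * f m n) M N"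
    proof (intro arg_cong[of _ _ "\<lambda>h. transfer P j h M N"] ext)
      fix m n
      have "f m n / q ^ m
        - (q ^ m * (q ^ n * f m n) - (if m = 0 then 0 else q ^ (m - 1) * (q ^ n * f (m - 1) n)))
        - (f m n / q ^ n - f m (Suc n) / q ^ Suc n) =
        gauss m n * (ker j m n / q ^ m - ker_pred j m n / q ^ m
        - q ^ m * q ^ n * (ker j m n - ker j m (Suc n)) - ker j m n / q ^ n)"
        unfolding left right by (simp add: f_def algebra_simps)
      thus "f m n / q ^ m
        - (q ^ m * (q ^ n * f m n) - (if m = 0 then 0 else q ^ (m - 1) * (q ^ n * f (m - 1) n)))
        - (f m n / q ^ n - f m (Suc n) / q ^ Suc n) = e * f m n"
        unfolding ham by (simp add: f_def)
    qed
    finally show ?thesis unfolding transfer_scale .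
  qed
  have E2: "q powi N * (?D M N - ?D M (N + 1)) + (?D M N - ?D (M - 1) N) / (q powi M * q powi N) - q powi M * ?D M N
      = - e * ?D M N"
    if "M \<le> int P" "N \<ge> 0" for M N
  proof -
    have f0': "f m (Suc j) / q ^ m = 0" for m by (simp add: f0)
    have "q powi N * (?D M N - ?D M (N + 1)) + (?D M N - ?D (M - 1) N) / (q powi M * q powi N) - q powi M * ?D M N =
      q powi N * (?D M N - ?D M (N + 1)) + q powi (- N) * (q powi (- M) * (?D M N - ?D (M - 1) N)) - q powi M * ?D M N"
      by (simp add: power_int_minus divide_inverse mult_ac)
    also have "\<dots> = transfer P j (\<lambda>m n. q ^ n * f m n
        + (f m n / q ^ m / q ^ n - f m (Suc n) / q ^ m / q ^ Suc n)
        - (q ^ m * f m n - (if m = 0 then 0 else q ^ (m - 1) * f (m - 1) n))) M N"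
      unfolding transfer_lower_m transfer_upper_n transfer_mult_m[OF that(1)] transfer_div_n[where f = "\<lambda>m n. f m n / q ^ m" and J = j, OF that(2) f0'] transfer_diff transfer_add ..
    also have "\<dots> = transfer P j (\<lambda>m n. - e * f m n) M N"
    proof (intro arg_cong[of _ _ "\<lambda>h. transfer P j h M N"] ext)
      fix m n
      have "f m (Suc n) / q ^ m / q ^ Suc n = gauss m n * q ^ n * ker j m (Suc n)"
        using right[of m n] by (simp add: field_simps)
      hence "q ^ n * f m n
        + (f m n / q ^ m / q ^ n - f m (Suc n) / q ^ m / q ^ Suc n)
        - (q ^ m * f m n - (if m = 0 then 0 else q ^ (m - 1) * f (m - 1) n)) =
        gauss m n * (q ^ n * (ker j m n - ker j m (Suc n)) + (ker j m n - ker_pred j m n) / (q ^ m * q ^ n)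
        - q ^ m * ker j m n)"
        unfolding left' by (simp add: f_def algebra_simps diff_divide_distrib)
      thus "q ^ n * f m n
        + (f m n / q ^ m / q ^ n - f m (Suc n) / q ^ m / q ^ Suc n)
        - (q ^ m * f m n - (if m = 0 then 0 else q ^ (m - 1) * f (m - 1) n)) = - e * f m n"
        unfolding ham by (simp add: f_def)
    qed
    finally show ?thesis unfolding transfer_scale .
  qed
  have rec: "?D (int M - 1) (int N) * (1 + q ^ M / q ^ N) =
        ?D (int M) (int N) * ((1 - q ^ M) * (1 + q ^ M * w) * (1 + q ^ M / w))"
      "?D (int M) (int (Suc N)) * (1 + q ^ M / q ^ N) =
        ?D (int M) (int N) * ((1 + 1 / q ^ N) * (1 - w / q ^ N) * (1 - 1 / (w * q ^ N)))"
    if "M \<le> P" for M N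
  proof -
    have "(?D (int M) (int N) - ?D (int M - 1) (int N)) / q ^ M
        - q ^ M * q ^ N * (?D (int M) (int N) - ?D (int M) (int (Suc N)))
        - ?D (int M) (int N) / q ^ N = (1 - w - 1 / w) * ?D (int M) (int N)"
      using E1[of "int M" "int N"] that by (simp add: e_def add.commute)
    moreover have "q ^ N * (?D (int M) (int N) - ?D (int M) (int (Suc N))) +
        (?D (int M) (int N) - ?D (int M - 1) (int N)) / (q ^ M * q ^ N) -
        q ^ M * ?D (int M) (int N) = - (1 - w - 1 / w) * ?D (int M) (int N)"
      using E2[of "int M" "int N"] that by (simp add: e_def add.commute)
    ultimately show "?D (int M - 1) (int N) * (1 + q ^ M / q ^ N) =
        ?D (int M) (int N) * ((1 - q ^ M) * (1 + q ^ M * w) * (1 + q ^ M / w))"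
      "?D (int M) (int (Suc N)) * (1 + q ^ M / q ^ N) =
        ?D (int M) (int N) * ((1 + 1 / q ^ N) * (1 - w / q ^ N) * (1 - 1 / (w * q ^ N)))"
      using toda_hamiltonians_converse[of "q ^ M" "q ^ N" w] by simp_all
  qed
  \<comment> \<open>The links force \<open>m = 0\<close> and \<open>n \<ge> j\<close>, the range
    gives \<open>n \<le> j\<close>. The weight of the one remaining term, \<open>gauss 0 j\<close>,
    is the eigenvalue.\<close>
  have corner: "?D 0 (int j) = q ^ (j\<^sup>2) * ker j 0 j"
  proof -
    have "(\<Sum>n\<le>j. recip_poch (int n - int j) * f m n) = f m j" for m
      by (cases j) (simp_all add: sum.atMost_Suc)
    hence "?D 0 (int j) = (\<Sum>m\<le>P. recip_poch (- int m) * f m j)"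
      unfolding transfer_def by (simp add: mult.assoc flip: sum_distrib_left)
    also have "\<dots> = f 0 j"
      by (subst sum.atMost_shift) simp
    finally show ?thesis by (simp add: f_def gauss_def)
  qed
  \<comment> \<open>Along \<open>M = 0\<close> the value is carried down from \<open>N = j\<close>,
    since the factor joining \<open>N\<close> to \<open>N + 1\<close> is nonzero below
    \<open>j\<close>. The induction on \<open>M\<close> starts from this edge.\<close>
  have bottom: "?D 0 (int (j - i)) = q ^ (j\<^sup>2) * ker j 0 (j - i)" if "i \<le> j" for i
    using that
  proof (induction i)
    case 0
    thus ?case using corner by simp
  next
    case (Suc i)
    define N where "N = j - Suc i"
    have N: "j - i = Suc N" "N < j" using Suc.prems by (auto simp: N_def)
    let ?r = "(1 + 1 / q ^ N) * (1 - w / q ^ N) * (1 - 1 / (w * q ^ N))"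
    have "ker j 0 (Suc N) \<noteq> 0" using N by (intro ker_nz) auto
    hence r: "?r \<noteq> 0"
      using ker_rec_n[of j 0 N] one_plus_power_div_nz[of 0 N] by (auto simp: w_def)
    have "?D 0 (int N) * ?r = q ^ (j\<^sup>2) * ker j 0 (Suc N) * (1 + q ^ 0 / q ^ N)"
      using rec(2)[of 0 N] Suc N by auto
    also have "\<dots> = q ^ (j\<^sup>2) * ker j 0 N * ?r"
      using ker_rec_n[of j 0 N] by (simp add: w_def)
    finally show ?case using r by (simp add: N_def)
  qed
  show ?thesis
    using assms
  proof (induction M)
    case 0
    thus ?case using bottom[of "j - N"] by (simp add: f_def)
  next
    case (Suc M)
    let ?r = "(1 - q ^ Suc M) * (1 + q ^ Suc M * w) * (1 + q ^ Suc M / w)"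
    have r: "?r \<noteq> 0"
      using one_minus_power_nz[of "Suc M"] one_plus_power_mult_nz[of "Suc M" j] one_plus_power_div_nz[of "Suc M" j]
      by (simp add: w_def)
    have "?D (int (Suc M)) (int N) * ?r = q ^ (j\<^sup>2) * ker j M N * (1 + q ^ Suc M / q ^ N)"
      using rec(1)[of "Suc M" N] Suc by (simp add: f_def)
    also have "\<dots> = q ^ (j\<^sup>2) * ker j (Suc M) N * ?r"
      unfolding w_def mult.assoc ker_rec_m[of j M N, symmetric, unfolded mult.assoc] ..
    finally show ?case using r by (simp add: f_def)
  qed
qed

end

section \<open>Bounds\<close>

text \<open>Since \<open>1 + t \<le> exp t\<close> and the exponents \<open>h i\<close> are
  distinct, the exponents of \<open>exp\<close> add up to at most one geometric series, whatever the
  number of factors.\<close>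

lemma norm_prod_le_exp_geometric:
  fixes z :: "nat \<Rightarrow> complex"
  assumes "0 \<le> r" "r < 1" "inj_on h A" "finite A" "\<And>i. i \<in> A \<Longrightarrow> norm (z i) \<le> r ^ h i"
  shows "norm (\<Prod>i\<in>A. 1 + z i) \<le> exp (1 / (1 - r))"
proof -
  have "norm (\<Prod>i\<in>A. 1 + z i) \<le> (\<Prod>i\<in>A. 1 + norm (z i))"
    unfolding prod_norm[symmetric] by (intro prod_mono conjI norm_ge_zero) (metis norm_one norm_triangle_ineq)
  also have "\<dots> \<le> exp (\<Sum>i\<in>A. norm (z i))"
    by (rule prod_le_exp_sum) auto
  also have "(\<Sum>i\<in>A. norm (z i)) \<le> (\<Sum>i\<in>A. r ^ h i)"
    using assms by (intro sum_mono) auto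
  also have "(\<Sum>i\<in>A. r ^ h i) = (\<Sum>k\<in>h ` A. r ^ k)"
    using assms by (simp add: sum.reindex)
  also have "\<dots> \<le> (\<Sum>k. r ^ k)"
    using assms by (intro sum_le_suminf summable_geometric) auto
  also have "\<dots> = 1 / (1 - r)"
    using assms by (intro suminf_geometric) auto
  finally show ?thesis by simp
qed

lemma double_sum_lessThan: "2 * (\<Sum>i<n. i) + n = n * n" for n :: nat
  by (induction n) auto

context q_nome begin

lemma gauss_0: "gauss 0 n = q ^ n\<^sup>2"
  by (simp add: gauss_def)

lemma inverse_sgn_poch_neg: "inverse (sgn_poch (- int n)) * q ^ (\<Sum>i<n. i) = qpoch (- 1) q n"
proof -
  have "inverse (sgn_poch (- int n)) = (\<Prod>i<n. 1 + 1 / q ^ i)"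
    by (cases "n = 0") (simp_all add: sgn_poch_def)
  moreover have "(\<Prod>i<n. 1 + 1 / q ^ i) * q ^ (\<Sum>i<n. i) = (\<Prod>i<n. (1 + 1 / q ^ i) * q ^ i)"
    by (simp add: power_sum prod.distrib)
  moreover have "(1 + 1 / q ^ i) * q ^ i = 1 - (- 1) * q ^ i" for i
    by (simp add: field_simps)
  ultimately show ?thesis by (simp only: qpoch_def)
qed

lemma norm_qpoch_neg_one_le: "norm (qpoch (- 1) q n) \<le> exp (1 / (1 - norm q))"
  using norm_prod_le_exp_geometric[of "norm q" id "{..<n}" "\<lambda>i. q ^ i"] norm_q
  by (simp add: qpoch_def norm_power)

text \<open>At \<open>m = 0\<close> the factor \<open>sgn_poch (- int n)\<close> cancels the factors
  \<open>1 + 1 / q ^ i\<close> of \<open>ker_n\<close>. Only two large factors remain: the product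
  \<open>v\<close>, and the reciprocal of \<open>sgn_poch (- int j)\<close>. The power of
  \<open>norm q\<close> clears exactly their negative powers of \<open>q\<close>.\<close>

lemma ker_bottom_le:
  obtains B where "B > 0"
    "\<And>j n. n \<le> j \<Longrightarrow> norm (ker j 0 n) * norm q ^ (j * n + (\<Sum>i<n. i) + (\<Sum>i<j. i)) \<le> B"
proof -
  obtain B where B: "B > 0" "\<And>n. norm (inverse (qpoch (- q) q n)) \<le> B"
    using inverse_qpoch_bounded[OF norm_q, of "- q"] by blast
  define E where "E = exp (1 / (1 - norm q))"
  have "norm (ker j 0 n) * norm q ^ (j * n + (\<Sum>i<n. i) + (\<Sum>i<j. i)) \<le> E * E * E * B" if "n \<le> j" for j n
  proof -
    define u where "u = (\<Prod>i<n. 1 - q ^ j / q ^ i)"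
    define v where "v = (\<Prod>i<n. 1 - 1 / (q ^ j * q ^ i))"
    have "sgn_poch (- int n) * ker_n j n = u * v"
      using one_plus_inverse_power_nz
      by (cases "n = 0") (simp_all add: sgn_poch_def ker_n_def prod.distrib u_def v_def mult.assoc)
    hence ker: "ker j 0 n = u * v * inverse (sgn_poch (- int j)) * inverse (qpoch (- q) q j)"
      by (simp add: ker_def divide_inverse mult.assoc) (simp add: sgn_poch_def)
    have v: "v * q ^ (j * n + (\<Sum>i<n. i)) = (\<Prod>i<n. q ^ (j + i) - 1)"
    proof -
      have "q ^ (j * n + (\<Sum>i<n. i)) = (\<Prod>i<n. q ^ (j + i))"
        by (simp add: power_sum[symmetric] sum.distrib mult.commute)
      hence "v * q ^ (j * n + (\<Sum>i<n. i)) = (\<Prod>i<n. (1 - 1 / (q ^ j * q ^ i)) * q ^ (j + i))"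
        by (simp add: v_def prod.distrib)
      moreover have "(1 - 1 / (q ^ j * q ^ i)) * q ^ (j + i) = q ^ (j + i) - 1" for i
        by (simp add: power_add field_simps)
      ultimately show ?thesis by (simp only:)
    qed
    have "norm v * norm q ^ (j * n + (\<Sum>i<n. i)) = norm (\<Prod>i<n. 1 + - (q ^ (j + i)))"
      unfolding norm_power[symmetric] norm_mult[symmetric] v by (simp add: norm_minus_commute flip: prod_norm)
    also have "\<dots> \<le> E"
      unfolding E_def using norm_q by (intro norm_prod_le_exp_geometric[of _ "\<lambda>i. j + i"]) (auto simp: norm_power)
    finally have v': "norm v * norm q ^ (j * n + (\<Sum>i<n. i)) \<le> E" .
    have "norm u = norm (\<Prod>i<n. 1 + - (q ^ (j - i)))"
      unfolding u_def using that by (intro arg_cong[of _ _ norm] prod.cong refl) (simp add: power_diff)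
    also have "\<dots> \<le> E"
      unfolding E_def using norm_q that
      by (intro norm_prod_le_exp_geometric[of _ "\<lambda>i. j - i"]) (auto simp: norm_power inj_on_def)
    finally have u: "norm u \<le> E" .
    have s: "norm (inverse (sgn_poch (- int j))) * norm q ^ (\<Sum>i<j. i) \<le> E"
      unfolding norm_power[symmetric] norm_mult[symmetric] inverse_sgn_poch_neg E_def
      by (rule norm_qpoch_neg_one_le)
    have "norm (ker j 0 n) * norm q ^ (j * n + (\<Sum>i<n. i) + (\<Sum>i<j. i)) =
      norm u * (norm v * norm q ^ (j * n + (\<Sum>i<n. i))) *
      (norm (inverse (sgn_poch (- int j))) * norm q ^ (\<Sum>i<j. i)) * norm (inverse (qpoch (- q) q j))"
      unfolding ker norm_mult power_add by (simp add: mult_ac)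
    also have "\<dots> \<le> E * E * E * B"
      using u v' s B by (intro mult_mono mult_nonneg_nonneg) (auto simp: E_def)
    finally show ?thesis .
  qed
  moreover have "E * E * E * B > 0" using B by (simp add: E_def)
  ultimately show thesis using that by blast
qed

text \<open>With \<open>d = j - n\<close>, twice the gap between \<open>j^2 + n^2\<close> and the
  exponent in \<open>ker_bottom_le\<close> is \<open>d^2 + j + n\<close>, which is at least
  \<open>2 * j\<close>. A factor \<open>norm q ^ j\<close> is left over; as
  \<open>n \<le> j\<close>, its two square roots give decay in \<open>j\<close> and in
  \<open>n\<close>.\<close>

lemma theta_gauss_ker_bottom_le:
  obtains B where "B > 0"
    "\<And>j n. norm (theta_coeff q j * (gauss 0 n * ker j 0 n)) \<le> B * sqrt (norm q) ^ j * sqrt (norm q) ^ n"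
proof -
  obtain B where B: "B > 0"
    "\<And>j n. n \<le> j \<Longrightarrow> norm (ker j 0 n) * norm q ^ (j * n + (\<Sum>i<n. i) + (\<Sum>i<j. i)) \<le> B"
    using ker_bottom_le by blast
  have "norm (theta_coeff q j * (gauss 0 n * ker j 0 n)) \<le> 2 * B * sqrt (norm q) ^ j * sqrt (norm q) ^ n" for j n
  proof (cases "n \<le> j")
    case False
    thus ?thesis using B(1) by (simp add: ker_eq_0)
  next
    case True
    let ?e = "j * n + (\<Sum>i<n. i) + (\<Sum>i<j. i)"
    define d where "d = j - n"
    have j: "j = n + d" using True by (simp add: d_def)
    have "d \<le> d * d" by (cases d) auto
    moreover have "j * n = n * n + d * n" "j * j = n * n + 2 * (d * n) + d * d"
      by (simp_all add: j algebra_simps)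
    ultimately have "j + ?e \<le> j\<^sup>2 + n\<^sup>2"
      using double_sum_lessThan[of n] double_sum_lessThan[of j] j
      unfolding power2_eq_square by linarith
    then obtain t where t: "j\<^sup>2 + n\<^sup>2 = ?e + (j + t)" by (metis add.commute add.left_commute le_Suc_ex)
    have "norm (theta_coeff q j * (gauss 0 n * ker j 0 n)) \<le> 2 * norm q ^ (j\<^sup>2 + n\<^sup>2) * norm (ker j 0 n)"
      by (auto simp: theta_coeff_def gauss_0 norm_mult norm_power power_add mult_ac)
    also have "\<dots> = 2 * (norm (ker j 0 n) * norm q ^ ?e) * norm q ^ (j + t)"
      unfolding t by (simp add: power_add mult_ac)
    also have "\<dots> \<le> 2 * B * norm q ^ j"
      using B(2)[OF True] B(1) norm_q by (intro mult_mono power_decreasing) auto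
    also have "norm q ^ j = sqrt (norm q) ^ j * sqrt (norm q) ^ j"
      by (simp flip: power_mult_distrib)
    also have "2 * B * (sqrt (norm q) ^ j * sqrt (norm q) ^ j) \<le> 2 * B * (sqrt (norm q) ^ j * sqrt (norm q) ^ n)"
      using True B(1) norm_q by (intro mult_left_mono power_decreasing) auto
    finally show ?thesis by (simp add: mult_ac)
  qed
  thus thesis using that[of "2 * B"] B(1) by simp
qed

text \<open>The right-hand factor stays away from 0: it is 2 for \<open>m = j\<close>, its power of
  \<open>q\<close> has modulus at most \<open>norm q\<close> for \<open>m > j\<close> and at least
  \<open>1 / norm q\<close> for \<open>m < j\<close>. In the last case both sides may be large, so
  they have to be compared with each other.\<close>

lemma one_plus_ratio_le:
  assumes "n \<le> j"
  shows "norm (1 + q ^ m / q ^ n) * (1 - norm q) \<le> 2 * norm (1 + q ^ m / q ^ j)"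
proof -
  define r where "r = norm q"
  have r: "0 < r" "r < 1" using norm_q by (auto simp: r_def)
  define u where "u = norm (q ^ m / q ^ j)"
  have "norm (q ^ m / q ^ n) = u * r ^ (j - n)"
    using assms by (simp add: u_def r_def norm_divide norm_power power_diff)
  also have "\<dots> \<le> u * 1"
    using r by (intro mult_left_mono power_le_one) (auto simp: u_def)
  finally have "norm (1 + q ^ m / q ^ n) \<le> 1 + u"
    using norm_triangle_ineq[of 1 "q ^ m / q ^ n"] by simp
  hence "norm (1 + q ^ m / q ^ n) * (1 - r) \<le> (1 + u) * (1 - r)"
    using r by (intro mult_right_mono) auto
  also have "\<dots> \<le> 2 * norm (1 + q ^ m / q ^ j)"
  proof (rule linorder_cases[of m j])
    assume "m = j"
    thus ?thesis using r by (simp add: u_def)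
  next
    assume "j < m"
    then obtain k where k: "m = j + Suc k" by (metis add_Suc_right less_iff_Suc_add)
    have "u = r ^ Suc k" unfolding u_def r_def k by (simp add: power_add norm_power norm_mult)
    also have "\<dots> \<le> r" using r by (simp add: mult_left_le power_le_one)
    finally have "u \<le> r" .
    moreover have "1 - u \<le> norm (1 + q ^ m / q ^ j)"
      using norm_diff_ineq[of 1 "q ^ m / q ^ j"] by (simp add: u_def)
    moreover have "(1 + u) * (1 - r) \<le> 2 * (1 - r)"
      using \<open>u \<le> r\<close> r by (intro mult_right_mono) auto
    moreover from calculation have "2 * (1 - r) \<le> 2 * norm (1 + q ^ m / q ^ j)" by argo
    ultimately show ?thesis by (meson order_trans)
  next
    assume "m < j"
    then obtain k where k: "j = m + Suc k" by (metis add_Suc_right less_iff_Suc_add)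
    have "u * r ^ Suc k = 1" unfolding u_def r_def k using q_nz by (simp add: power_add norm_power norm_mult norm_divide)
    moreover have "r ^ Suc k \<le> r" using r by (simp add: mult_left_le power_le_one)
    moreover have "u \<ge> 0" by (simp add: u_def)
    ultimately have "1 \<le> u * r" by (metis mult_left_mono)
    moreover have "u - 1 \<le> norm (1 + q ^ m / q ^ j)"
      using norm_diff_ineq[of "q ^ m / q ^ j" 1] by (simp add: u_def add.commute)
    moreover have "u * r \<le> u * 1" using r \<open>u \<ge> 0\<close> by (intro mult_left_mono) auto
    moreover from calculation have "0 \<le> (1 - r) * (u - 1)"
      using r by (intro mult_nonneg_nonneg) auto
    ultimately show ?thesis using r by (simp add: algebra_simps)
  qed
  finally show ?thesis by (simp add: r_def)
qed

text \<open>The weight gains \<open>q^(2m+1+n)\<close>. Each of the three denominators in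
  \<open>ker_rec_m\<close> costs at most \<open>1 / (1 - norm q)\<close>, the last one jointly with
  the numerator and at the price of a factor 2.\<close>

lemma gauss_ker_step:
  assumes "n \<le> j"
  shows "norm (gauss (Suc m) n * ker j (Suc m) n) \<le>
         2 / (1 - norm q) ^ 3 * norm q ^ (2 * m + 1) * norm (gauss m n * ker j m n)"
proof -
  define r where "r = norm q"
  have r: "0 < r" "r < 1" using norm_q by (auto simp: r_def)
  let ?x = "q ^ Suc m"
  have x: "norm ?x \<le> r"
    using r by (simp add: r_def norm_mult norm_power mult_left_le power_le_one)
  have "norm (?x * q ^ j) \<le> r * 1"
    unfolding norm_mult using x r by (intro mult_mono) (auto simp: norm_power r_def power_le_one)
  hence a: "1 - r \<le> norm (1 + ?x * q ^ j)"
    using norm_diff_ineq[of 1 "?x * q ^ j"] by simp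
  have b: "1 - r \<le> norm (1 - ?x)"
    using norm_triangle_ineq2[of 1 ?x] x by simp
  have c: "norm (1 + ?x / q ^ n) * (1 - r) \<le> 2 * norm (1 + ?x / q ^ j)"
    unfolding r_def by (rule one_plus_ratio_le[OF assms])
  define D where "D = (1 - ?x) * (1 + ?x * q ^ j) * (1 + ?x / q ^ j)"
  have D: "D \<noteq> 0"
    using one_minus_power_nz[of "Suc m"] one_plus_power_mult_nz[of "Suc m" j] one_plus_power_div_nz[of "Suc m" j]
    by (simp add: D_def)
  have "norm (1 + ?x / q ^ n) * (1 - r) ^ 3 = (1 - r) * (1 - r) * (norm (1 + ?x / q ^ n) * (1 - r))"
    by (simp add: power3_eq_cube)
  also have "\<dots> \<le> norm (1 - ?x) * norm (1 + ?x * q ^ j) * (2 * norm (1 + ?x / q ^ j))"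
    using r by (intro mult_mono[OF mult_mono[OF b a] c]) auto
  also have "\<dots> = 2 * norm D" by (simp add: D_def norm_mult)
  finally have ratio: "norm (1 + ?x / q ^ n) \<le> 2 / (1 - r) ^ 3 * norm D"
    using r by (simp add: pos_le_divide_eq)
  have "norm (gauss (Suc m) n) \<le> norm (gauss m n) * r ^ (2 * m + 1)"
  proof -
    have "norm (gauss (Suc m) n) = norm (gauss m n) * r ^ (2 * m + 1) * r ^ n"
      unfolding mult_2 by (simp add: gauss_Suc_left norm_mult norm_power r_def power_add mult_ac)
    also have "\<dots> \<le> norm (gauss m n) * r ^ (2 * m + 1) * 1"
      using r by (intro mult_left_mono power_le_one) auto
    finally show ?thesis by simp
  qed
  moreover have "norm (ker j (Suc m) n) * norm D \<le> norm (ker j m n) * (2 / (1 - r) ^ 3 * norm D)"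
  proof -
    have "norm (ker j (Suc m) n) * norm D = norm (ker j m n) * norm (1 + ?x / q ^ n)"
      unfolding norm_mult[symmetric] D_def ker_rec_m ..
    also have "\<dots> \<le> norm (ker j m n) * (2 / (1 - r) ^ 3 * norm D)"
      using ratio by (intro mult_left_mono) auto
    finally show ?thesis .
  qed
  hence "norm (ker j (Suc m) n) \<le> norm (ker j m n) * (2 / (1 - r) ^ 3)"
    unfolding mult.assoc[symmetric] by (rule mult_right_le_imp_le) (simp add: D)
  ultimately have "norm (gauss (Suc m) n) * norm (ker j (Suc m) n) \<le>
      (norm (gauss m n) * r ^ (2 * m + 1)) * (norm (ker j m n) * (2 / (1 - r) ^ 3))"
    using r by (intro mult_mono) auto
  thus ?thesis by (simp add: norm_mult r_def mult_ac)
qed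

text \<open>The product of the first \<open>m\<close> step factors of \<open>gauss_ker_step\<close>,
  the odd exponents adding up to \<open>m^2\<close>.\<close>

definition growth :: "nat \<Rightarrow> real" where
  "growth m = (2 / (1 - norm q) ^ 3) ^ m * norm q ^ m\<^sup>2"

lemma growth_nonneg: "growth m \<ge> 0"
  using norm_q by (simp add: growth_def)

text \<open>The product form of the bound lets the sums over \<open>j\<close>, \<open>m\<close> and
  \<open>n\<close> be dominated independently of each other.\<close>

lemma theta_gauss_ker_le:
  obtains B where "B > 0"
    "\<And>j m n. norm (theta_coeff q j * (gauss m n * ker j m n)) \<le>
      B * sqrt (norm q) ^ j * sqrt (norm q) ^ n * growth m"
proof -
  obtain B where B: "B > 0"
    "\<And>j n. norm (theta_coeff q j * (gauss 0 n * ker j 0 n)) \<le> B * sqrt (norm q) ^ j * sqrt (norm q) ^ n"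
    using theta_gauss_ker_bottom_le by blast
  have step: "norm (gauss m n * ker j m n) \<le> growth m * norm (gauss 0 n * ker j 0 n)" for j m n
  proof (cases "n \<le> j")
    case True
    show ?thesis
    proof (induction m)
      case 0
      show ?case by (simp add: growth_def)
    next
      case (Suc m)
      let ?c = "2 / (1 - norm q) ^ 3"
      have c: "?c \<ge> 0" using norm_q by simp
      have "norm (gauss (Suc m) n * ker j (Suc m) n) \<le> ?c * norm q ^ (2 * m + 1) * norm (gauss m n * ker j m n)"
        by (rule gauss_ker_step[OF True])
      also have "\<dots> \<le> ?c * norm q ^ (2 * m + 1) * (growth m * norm (gauss 0 n * ker j 0 n))"
        using c by (intro mult_left_mono Suc.IH mult_nonneg_nonneg) auto
      also have "\<dots> = growth (Suc m) * norm (gauss 0 n * ker j 0 n)"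
      proof -
        have "(Suc m)\<^sup>2 = m\<^sup>2 + (2 * m + 1)" by (simp add: power2_eq_square)
        thus ?thesis by (simp only: growth_def power_add power_Suc mult_ac)
      qed
      finally show ?case .
    qed
  qed (simp add: ker_eq_0)
  have "norm (theta_coeff q j * (gauss m n * ker j m n)) \<le>
      B * sqrt (norm q) ^ j * sqrt (norm q) ^ n * growth m" for j m n
  proof -
    have "norm (theta_coeff q j * (gauss m n * ker j m n)) \<le>
        norm (theta_coeff q j) * (growth m * norm (gauss 0 n * ker j 0 n))"
      unfolding norm_mult[of "theta_coeff q j"] by (intro mult_left_mono step) auto
    also have "\<dots> = growth m * norm (theta_coeff q j * (gauss 0 n * ker j 0 n))"
      by (simp add: norm_mult)
    also have "\<dots> \<le> growth m * (B * sqrt (norm q) ^ j * sqrt (norm q) ^ n)"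
      by (intro mult_left_mono B growth_nonneg)
    finally show ?thesis by (simp add: mult_ac)
  qed
  thus thesis using that B(1) by blast
qed

text \<open>\<open>growth m\<close> is the \<open>m\<close>-th power of
  \<open>c * norm q ^ m\<close>, which eventually drops below 1/2.\<close>

lemma summable_growth: "summable growth"
proof (rule summable_comparison_test_ev)
  define c where "c = 2 / (1 - norm q) ^ 3"
  have "(\<lambda>m. c * norm q ^ m) \<longlonglongrightarrow> c * 0"
    using norm_q by (intro tendsto_intros) auto
  hence "\<forall>\<^sub>F m in sequentially. c * norm q ^ m < 1 / 2"
    by (intro order_tendstoD) auto
  thus "\<forall>\<^sub>F m in sequentially. norm (growth m) \<le> (1 / 2) ^ m"
  proof eventually_elim
    case (elim m)
    have "growth m = (c * norm q ^ m) ^ m"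
      by (simp only: growth_def c_def power_mult_distrib power2_eq_square power_mult)
    moreover have "(c * norm q ^ m) ^ m \<le> (1 / 2) ^ m"
      using elim norm_q by (intro power_mono) (auto simp: c_def)
    ultimately show ?case using growth_nonneg[of m] by simp
  qed
  show "summable (\<lambda>m. (1 / 2) ^ m :: real)" by (rule summable_geometric) simp
qed

section \<open>Expansion of the first level\<close>

lemma gauss_nz: "gauss m n \<noteq> 0"
  by (simp add: gauss_def)

lemma summable_theta_ker: "summable (\<lambda>j. norm (theta_coeff q j * ker j m n))"
proof -
  obtain B where B: "B > 0" "\<And>j m n. norm (theta_coeff q j * (gauss m n * ker j m n)) \<le>
      B * sqrt (norm q) ^ j * sqrt (norm q) ^ n * growth m"
    using theta_gauss_ker_le by blast
  have "summable (\<lambda>j. (B * sqrt (norm q) ^ n * growth m / norm (gauss m n)) * sqrt (norm q) ^ j)"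
    using norm_q by (intro summable_mult summable_geometric) auto
  thus ?thesis
  proof (rule summable_comparison_test_ev[rotated], intro always_eventually allI)
    fix j
    have "norm (theta_coeff q j * ker j m n) * norm (gauss m n) \<le> B * sqrt (norm q) ^ j * sqrt (norm q) ^ n * growth m"
      using B(2)[of j m n] by (simp add: norm_mult mult_ac)
    thus "norm (norm (theta_coeff q j * ker j m n)) \<le> (B * sqrt (norm q) ^ n * growth m / norm (gauss m n)) * sqrt (norm q) ^ j"
      using gauss_nz[of m n] by (simp add: pos_le_divide_eq mult_ac)
  qed
qed

text \<open>The series of the first-level expansion. Recurrences in \<open>m\<close> and
  \<open>n\<close> reduce it to \<open>theta_ker 0 0\<close>, which a limit determines.\<close>

definition theta_ker :: "nat \<Rightarrow> nat \<Rightarrow> complex" where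
  "theta_ker m n = (\<Sum>j. theta_coeff q j * ker j m n)"

lemma theta_ker_sums: "(\<lambda>j. theta_coeff q j * ker j m n) sums theta_ker m n"
  unfolding theta_ker_def by (rule summable_sums[OF summable_norm_cancel[OF summable_theta_ker]])

text \<open>Two of the three products telescope in the ratio of the values at \<open>j + 1\<close>
  and \<open>j\<close>. Denominators are cleared because they vanish at \<open>j = 0\<close> and at
  \<open>n = j + 1\<close>.\<close>

lemma ker_n_rec_j:
  "ker_n (Suc j) n * ((1 - q ^ j) * (1 - q ^ Suc j / q ^ n)) =
   ker_n j n * ((1 - q ^ j * q ^ n) * (1 - q ^ Suc j) / q ^ n)"
proof (induction n)
  case (Suc n)
  define y where "y = q ^ n"
  define w where "w = q ^ j"
  have nz: "y \<noteq> 0" "w \<noteq> 0" by (simp_all add: y_def w_def)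
  have "ker_n (Suc j) (Suc n) * ((1 - w) * (1 - q * w / (q * y))) =
     (ker_n (Suc j) n * ((1 - w) * (1 - q * w / y))) * ((1 + 1 / y) * (1 - 1 / (q * w * y)) * (1 - w / y))"
    using nz by (simp add: ker_n_Suc y_def w_def)
  also have "\<dots> = ker_n j n * ((1 - w * y) * (1 - q * w) / y) * ((1 + 1 / y) * (1 - 1 / (q * w * y)) * (1 - w / y))"
    using Suc.IH by (simp add: y_def w_def)
  also have "\<dots> = ker_n j n * ((1 + 1 / y) * (1 - w / y) * (1 - 1 / (w * y))) * ((1 - w * (q * y)) * (1 - q * w) / (q * y))"
  proof -
    have "(1 - w * y) * (1 - 1 / (q * w * y)) = (1 - 1 / (w * y)) * (1 - w * (q * y)) / q"
      using nz by (simp add: field_simps)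
    hence "x * ((1 - w * y) * a / y) * (b * (1 - 1 / (q * w * y)) * c) =
           x * (b * c * (1 - 1 / (w * y))) * ((1 - w * (q * y)) * a / (q * y))" for x a b c
      by (simp add: divide_inverse mult_ac)
    thus ?thesis .
  qed
  finally show ?case by (simp add: ker_n_Suc y_def w_def)
qed simp

lemma sgn_poch_rec_j:
  "sgn_poch (int m - int j) * sgn_poch (int m + int j) * (1 + q ^ m * q ^ Suc j) =
   sgn_poch (int m - int (Suc j)) * sgn_poch (int m + int (Suc j)) * (1 + q ^ m / q ^ j)"
proof -
  have "sgn_poch (int m - int j) = sgn_poch (int m - int (Suc j)) * (1 + q ^ m / q ^ j)"
    using sgn_poch_rec[of "int m - int j"] by (simp add: power_int_diff algebra_simps)
  moreover have "sgn_poch (int m + int (Suc j)) = sgn_poch (int m + int j) * (1 + q ^ m * q ^ Suc j)"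
    using sgn_poch_rec[of "int m + int (Suc j)"] by (simp add: power_int_add algebra_simps)
  ultimately show ?thesis by (simp only: mult_ac)
qed

text \<open>The relation between the \<open>ker_n\<close> is a parameter: at \<open>j = 0\<close>
  that of \<open>ker_n_rec_j\<close> reads \<open>0 = 0\<close>, and for \<open>n = 0\<close> the
  trivial one with \<open>a = b = 1\<close> takes its place.\<close>

lemma ker_rec_j:
  assumes "ker_n (Suc j) n * a = ker_n j n * b"
  shows "ker (Suc j) m n * ((1 + q ^ m * q ^ Suc j) * a) = ker j m n * ((1 + q ^ m / q ^ j) * b)"
proof -
  define s where "s = sgn_poch (int m - int j) * sgn_poch (int m + int j)"
  define t where "t = sgn_poch (int m - int (Suc j)) * sgn_poch (int m + int (Suc j))"
  have st: "s * (1 + q ^ m * q ^ Suc j) = t * (1 + q ^ m / q ^ j)" "s \<noteq> 0" "t \<noteq> 0"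
    unfolding s_def t_def using sgn_poch_rec_j[of m j] by auto
  define c where "c = sgn_poch (int m - int n) / qpoch q q m"
  have "ker (Suc j) m n = c * ker_n (Suc j) n / t" "ker j m n = c * ker_n j n / s"
    unfolding ker_def s_def t_def c_def by (simp_all add: mult.assoc)
  moreover have "c * k / t * (u * a) = c * l / s * (v * b)" if "k * a = l * b" "s * u = t * v" for k l u v
  proof -
    have "c * k / t * (u * a) = c * (k * a) * (s * u) / (s * t)" using st by simp
    also have "\<dots> = c * l / s * (v * b)" unfolding that using st by simp
    finally show ?thesis .
  qed
  ultimately show ?thesis using assms st(1) by metis
qed

lemma theta_coeff_Suc: "j > 0 \<Longrightarrow> theta_coeff q (Suc j) = - theta_coeff q j * (q ^ j * q ^ j * q)"
  by (simp add: theta_coeff_def power2_eq_square power_add)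

text \<open>With \<open>x = q^m\<close>, the bracket in \<open>T\<close> is, up to the factor
  \<open>x (1 - x)\<close>, what is left of \<open>(1 - x)(1 + x q^j)(1 + x / q^j)\<close> after
  subtracting \<open>(1 - x)^2 (1 + x / q^n)\<close>. It splits so that
  \<open>T j = G j + H j\<close> and \<open>G (j + 1) = - H j\<close> for
  \<open>j \<ge> 1\<close>.\<close>

lemma theta_ker_telescope:
  fixes m n :: nat
  defines "T \<equiv> \<lambda>j. theta_coeff q j * ker j m n *
    (q ^ j + 1 / q ^ j + 1 + q ^ m - 1 / q ^ n + q ^ m / q ^ n)"
  defines "H \<equiv> \<lambda>j. theta_coeff q j * ker j m n *
    ((q ^ j + q ^ m) * (1 - q ^ j * q ^ n) / (q ^ n * (1 - q ^ j)))"
  shows "(\<Sum>j\<le>Suc J. T j) = H (Suc J)"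
proof -
  define G where "G = (\<lambda>j. theta_coeff q j * ker j m n *
    ((1 + q ^ m * q ^ j) * (1 / q ^ j - 1 / q ^ n) / (1 - q ^ j)))"
  have T: "T (Suc j) = G (Suc j) + H (Suc j)" for j
  proof -
    define w where "w = q ^ Suc j"
    have w: "1 - w \<noteq> 0" "w \<noteq> 0" using one_minus_power_nz[of "Suc j"] by (auto simp: w_def)
    have "w + 1 / w + 1 + x - 1 / y + x / y =
      (1 + x * w) * (1 / w - 1 / y) / (1 - w) + (w + x) * (1 - w * y) / (y * (1 - w))"
      if "y \<noteq> 0" for x y :: complex
      using w that by (simp add: divide_simps) algebra
    from this[of "q ^ n" "q ^ m"] show ?thesis
      unfolding T_def G_def H_def w_def[symmetric] by (simp add: distrib_left)
  qed
  have G: "G (Suc (Suc j)) = - H (Suc j)" for j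
  proof -
    define w where "w = q ^ Suc j"
    define x where "x = q ^ m"
    define y where "y = q ^ n"
    have w: "1 - w \<noteq> 0" "1 - q * w \<noteq> 0" "w \<noteq> 0" "y \<noteq> 0"
      using one_minus_power_nz[of "Suc j"] one_minus_power_nz[of "Suc (Suc j)"] by (auto simp: w_def y_def)
    have "ker (Suc (Suc j)) m n * ((1 + x * (q * w)) * ((1 - w) * (1 - q * w / y))) =
          ker (Suc j) m n * ((1 + x / w) * ((1 - w * y) * (1 - q * w) / y))"
      using ker_rec_j[OF ker_n_rec_j, of "Suc j" m n] by (simp add: w_def x_def y_def)
    hence k: "ker (Suc (Suc j)) m n * ((1 + x * (q * w)) * (1 - q * w / y)) / (1 - q * w) =
          ker (Suc j) m n * ((1 + x / w) * (1 - w * y) / (y * (1 - w)))"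
      using w by (simp add: divide_simps) (simp add: algebra_simps)
    have "G (Suc (Suc j)) = - theta_coeff q (Suc j) * (w * w * q) *
        (ker (Suc (Suc j)) m n * ((1 + x * (q * w)) * (1 / (q * w) - 1 / y) / (1 - q * w)))"
      unfolding G_def using theta_coeff_Suc[of "Suc j"] by (simp add: w_def x_def y_def mult_ac)
    also have "1 / (q * w) - 1 / y = (1 - q * w / y) / (q * w)"
      using w by (simp add: field_simps)
    also have "ker (Suc (Suc j)) m n * ((1 + x * (q * w)) * ((1 - q * w / y) / (q * w)) / (1 - q * w)) =
      ker (Suc (Suc j)) m n * ((1 + x * (q * w)) * (1 - q * w / y)) / (1 - q * w) / (q * w)"
      by simp
    also have "\<dots> = ker (Suc j) m n * ((1 + x / w) * (1 - w * y) / (y * (1 - w))) / (q * w)"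
      unfolding k ..
    also have "- theta_coeff q (Suc j) * (w * w * q) * (ker (Suc j) m n * ((1 + x / w) * (1 - w * y) / (y * (1 - w))) / (q * w)) =
       - (theta_coeff q (Suc j) * ker (Suc j) m n * ((w * (1 + x / w)) * (1 - w * y) / (y * (1 - w))))"
      using w by simp
    also have "w * (1 + x / w) = w + x" using w by (simp add: field_simps)
    finally show ?thesis by (simp add: H_def w_def x_def y_def)
  qed
  \<comment> \<open>The splitting fails at \<open>j = 0\<close>, where \<open>1 - q^j\<close>
    vanishes. For \<open>n = 0\<close> the factor 2 in \<open>theta_coeff q 1\<close> makes the two
    terms cancel; for \<open>n = 1\<close> the bracket of \<open>G\<close> is zero, for larger
    \<open>n\<close> the kernel is.\<close>
  have "T 0 + G (Suc 0) = 0"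
  proof (cases n)
    case 0
    have "ker 1 m 0 * (1 + q ^ m * q) = ker 0 m 0 * (1 + q ^ m)"
      using ker_rec_j[of 0 0 1 1 m] by simp
    moreover have "G (Suc 0) = - 2 * (ker 1 m 0 * (1 + q ^ m * q)) * (q * (1 / q - 1) / (1 - q))"
      by (simp add: G_def 0 theta_coeff_def)
    moreover have "q * (1 / q - 1) / (1 - q) = 1"
      using one_minus_power_nz[of 1] by (simp add: field_simps)
    moreover have "T 0 = 2 * (ker 0 m 0 * (1 + q ^ m))"
      by (simp add: T_def 0 algebra_simps)
    ultimately show ?thesis by simp
  next
    case (Suc n')
    hence "T 0 = 0" by (simp add: T_def ker_eq_0)
    moreover have "G (Suc 0) = 0"
      by (cases n') (simp_all add: G_def Suc ker_eq_0)
    ultimately show ?thesis by simp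
  qed
  thus ?thesis
    by (induction J) (simp_all add: T G add.assoc[symmetric])
qed

lemma theta_ker_weighted_sums:
  "(\<lambda>j. theta_coeff q j * ker j m n * (q ^ j + 1 / q ^ j + 1 + q ^ m - 1 / q ^ n + q ^ m / q ^ n)) sums 0"
proof -
  have "(\<lambda>j. theta_coeff q j * ker j m n) \<longlonglongrightarrow> 0"
    using theta_ker_sums summable_LIMSEQ_zero sums_summable by blast
  moreover have "(\<lambda>j. (q ^ j + q ^ m) * (1 - q ^ j * q ^ n) / (q ^ n * (1 - q ^ j))) \<longlonglongrightarrow>
      (0 + q ^ m) * (1 - 0 * q ^ n) / (q ^ n * (1 - 0))"
    using norm_q by (intro tendsto_intros LIMSEQ_power_zero) auto
  ultimately have "(\<lambda>j. theta_coeff q j * ker j m n *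
     ((q ^ j + q ^ m) * (1 - q ^ j * q ^ n) / (q ^ n * (1 - q ^ j)))) \<longlonglongrightarrow> 0"
    using tendsto_mult by fastforce
  hence "(\<lambda>J. \<Sum>j\<le>Suc J. theta_coeff q j * ker j m n *
      (q ^ j + 1 / q ^ j + 1 + q ^ m - 1 / q ^ n + q ^ m / q ^ n)) \<longlonglongrightarrow> 0"
    unfolding theta_ker_telescope by (rule LIMSEQ_Suc)
  thus ?thesis unfolding sums_def_le by (rule LIMSEQ_imp_Suc)
qed

text \<open>The factor in \<open>ker_rec_m\<close> is split into a part free of \<open>j\<close> and
  a multiple of the bracket in \<open>theta_ker_weighted_sums\<close>, which sums to 0.\<close>

lemma theta_ker_rec_m: "theta_ker m n = (1 - q ^ Suc m)\<^sup>2 * theta_ker (Suc m) n"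
proof -
  define x where "x = q ^ Suc m"
  define y where "y = q ^ n"
  have y: "y \<noteq> 0" by (simp add: y_def)
  have pt: "theta_coeff q j * ker j m n * (1 + x / y) =
      (1 - x)\<^sup>2 * (1 + x / y) * (theta_coeff q j * ker j (Suc m) n) + (1 - x) * x *
      (theta_coeff q j * ker j (Suc m) n * (q ^ j + 1 / q ^ j + 1 + x - 1 / y + x / y))" for j
  proof -
    define w where "w = q ^ j"
    have w: "w \<noteq> 0" by (simp add: w_def)
    have "(1 - x) * (1 + x * w) * (1 + x / w) =
      (1 - x)\<^sup>2 * (1 + x / y) + (1 - x) * x * (w + 1 / w + 1 + x - 1 / y + x / y)"
      using w y by (simp add: divide_simps) algebra
    moreover have "ker j m n * (1 + x / y) = ker j (Suc m) n * ((1 - x) * (1 + x * w) * (1 + x / w))"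
      unfolding x_def y_def w_def ker_rec_m ..
    ultimately have "theta_coeff q j * (ker j m n * (1 + x / y)) = theta_coeff q j * (ker j (Suc m) n *
      ((1 - x)\<^sup>2 * (1 + x / y) + (1 - x) * x * (w + 1 / w + 1 + x - 1 / y + x / y)))"
      by simp
    thus ?thesis by (simp only: w_def distrib_left mult_ac)
  qed
  have "(\<lambda>j. theta_coeff q j * ker j m n * (1 + x / y)) sums (theta_ker m n * (1 + x / y))"
    by (intro sums_mult2 theta_ker_sums)
  moreover have "(\<lambda>j. theta_coeff q j * ker j m n * (1 + x / y)) sums
      ((1 - x)\<^sup>2 * (1 + x / y) * theta_ker (Suc m) n + (1 - x) * x * 0)"
    unfolding pt unfolding x_def y_def by (intro sums_add sums_mult theta_ker_sums theta_ker_weighted_sums)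
  ultimately have "theta_ker m n * (1 + x / y) = (1 - x)\<^sup>2 * (1 + x / y) * theta_ker (Suc m) n + (1 - x) * x * 0"
    by (rule sums_unique2)
  thus ?thesis
    using one_plus_power_div_nz[of "Suc m" n] by (simp add: x_def y_def del: power_Suc)
qed

text \<open>
  Eliminating \<open>q^j + q^-j\<close> between the two recurrences of the kernel gives a relation free of \<open>j\<close>, which
  therefore holds for the sum as well. It degenerates at \<open>m = 0\<close>.
\<close>

lemma theta_ker_rec_n_Suc: "theta_ker (Suc m) (Suc n) = (1 + 1 / q ^ n)\<^sup>2 * theta_ker (Suc m) n"
proof -
  define x where "x = q ^ Suc m"
  define y where "y = q ^ n"
  have nz: "y \<noteq> 0" "x \<noteq> 0" "1 - x \<noteq> 0" "1 + x / y \<noteq> 0"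
    using one_minus_power_nz[of "Suc m"] one_plus_power_div_nz[of "Suc m" n] by (simp_all add: y_def x_def)
  let ?c = "(1 + 1 / y) / y"
  have pt: "(x * (1 - x) * (1 + x / y)) * (theta_coeff q j * ker j (Suc m) (Suc n)) =
      (?c * (1 - x ^ 3) + x * (1 - x) * (1 + 1 / y ^ 3)) * (theta_coeff q j * ker j (Suc m) n) -
      ?c * (1 + x / y) * (theta_coeff q j * ker j m n)" for j
  proof -
    define w where "w = q ^ j"
    have w: "w \<noteq> 0" by (simp add: w_def)
    have id: "x * (1 - x) * ((1 + 1 / y) * (1 - w / y) * (1 - 1 / (w * y))) =
      ?c * (1 - x ^ 3) + x * (1 - x) * (1 + 1 / y ^ 3) - ?c * ((1 - x) * (1 + x * w) * (1 + x / w))"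
      using w nz(1) by (simp add: divide_simps power3_eq_cube) algebra
    have m: "ker j m n * (1 + x / y) = ker j (Suc m) n * ((1 - x) * (1 + x * w) * (1 + x / w))"
      unfolding x_def y_def w_def ker_rec_m ..
    have n: "ker j (Suc m) (Suc n) * (1 + x / y) =
        ker j (Suc m) n * ((1 + 1 / y) * (1 - w / y) * (1 - 1 / (w * y)))"
      unfolding x_def y_def w_def ker_rec_n ..
    have "(x * (1 - x) * (1 + x / y)) * (theta_coeff q j * ker j (Suc m) (Suc n)) =
       x * (1 - x) * theta_coeff q j * (ker j (Suc m) (Suc n) * (1 + x / y))"
      by (simp only: mult_ac)
    also have "\<dots> = theta_coeff q j * ker j (Suc m) n * (x * (1 - x) * ((1 + 1 / y) * (1 - w / y) * (1 - 1 / (w * y))))"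
      unfolding n by (simp only: mult_ac)
    also have "\<dots> = (?c * (1 - x ^ 3) + x * (1 - x) * (1 + 1 / y ^ 3)) * (theta_coeff q j * ker j (Suc m) n) -
      ?c * theta_coeff q j * (ker j (Suc m) n * ((1 - x) * (1 + x * w) * (1 + x / w)))"
      unfolding id by (simp only: right_diff_distrib mult_ac)
    also have "\<dots> = (?c * (1 - x ^ 3) + x * (1 - x) * (1 + 1 / y ^ 3)) * (theta_coeff q j * ker j (Suc m) n) -
      ?c * (1 + x / y) * (theta_coeff q j * ker j m n)"
      unfolding m[symmetric] by (simp only: mult_ac)
    finally show ?thesis .
  qed
  have "(\<lambda>j. (x * (1 - x) * (1 + x / y)) * (theta_coeff q j * ker j (Suc m) (Suc n))) sums
        ((x * (1 - x) * (1 + x / y)) * theta_ker (Suc m) (Suc n))"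
    by (intro sums_mult theta_ker_sums)
  moreover have "(\<lambda>j. (x * (1 - x) * (1 + x / y)) * (theta_coeff q j * ker j (Suc m) (Suc n))) sums
        ((?c * (1 - x ^ 3) + x * (1 - x) * (1 + 1 / y ^ 3)) * theta_ker (Suc m) n -
         ?c * (1 + x / y) * theta_ker m n)"
    unfolding pt by (intro sums_diff sums_mult theta_ker_sums)
  ultimately have "(x * (1 - x) * (1 + x / y)) * theta_ker (Suc m) (Suc n) =
      (?c * (1 - x ^ 3) + x * (1 - x) * (1 + 1 / y ^ 3)) * theta_ker (Suc m) n -
         ?c * (1 + x / y) * theta_ker m n"
    by (rule sums_unique2)
  also have "\<dots> = (?c * (1 - x ^ 3) + x * (1 - x) * (1 + 1 / y ^ 3) - ?c * (1 + x / y) * (1 - x)\<^sup>2) * theta_ker (Suc m) n"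
    unfolding theta_ker_rec_m[of m n] x_def[symmetric] by (simp add: algebra_simps)
  also have "?c * (1 - x ^ 3) + x * (1 - x) * (1 + 1 / y ^ 3) - ?c * (1 + x / y) * (1 - x)\<^sup>2 =
      (x * (1 - x) * (1 + x / y)) * (1 + 1 / y)\<^sup>2"
    using nz(1) by (simp add: divide_simps power3_eq_cube power2_eq_square) algebra
  finally show ?thesis using nz by (simp add: y_def)
qed

text \<open>The missing case \<open>m = 0\<close> is inherited from \<open>m + 1\<close>, because
  \<open>theta_ker_rec_m\<close> expresses each value through the next.\<close>

lemma theta_ker_rec_n: "theta_ker m (Suc n) = (1 + 1 / q ^ n)\<^sup>2 * theta_ker m n"
proof -
  have "(1 - q ^ Suc m)\<^sup>2 * theta_ker (Suc m) (Suc n) =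
      (1 + 1 / q ^ n)\<^sup>2 * ((1 - q ^ Suc m)\<^sup>2 * theta_ker (Suc m) n)"
    unfolding theta_ker_rec_n_Suc by (simp only: mult_ac)
  thus ?thesis unfolding theta_ker_rec_m[of m, symmetric] .
qed

lemma theta_ker_eq:
  "theta_ker m n = theta_ker 0 0 * (\<Prod>i<n. 1 + 1 / q ^ i)\<^sup>2 / (qpoch q q m)\<^sup>2"
proof -
  have "theta_ker m 0 = theta_ker 0 0 / (qpoch q q m)\<^sup>2" for m
  proof (induction m)
    case (Suc m)
    have "theta_ker (Suc m) 0 = theta_ker m 0 / (1 - q ^ Suc m)\<^sup>2"
      using theta_ker_rec_m[of m 0] one_minus_power_nz[of "Suc m"] by (simp del: power_Suc)
    thus ?case
      by (simp add: Suc qpoch_self_Suc power_mult_distrib del: power_Suc)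
  qed simp
  note base = this[of m]
  show ?thesis
  proof (induction n)
    case 0
    show ?case by (subst base) simp
  next
    case (Suc n)
    show ?case
      unfolding theta_ker_rec_n[of m n] Suc.IH prod.lessThan_Suc power_mult_distrib by (simp add: mult_ac)
  qed
qed

end

section \<open>Limits and summation over one level\<close>

lemma summable_on_product_real:
  fixes f :: "'a \<Rightarrow> real" and g :: "'b \<Rightarrow> real"
  assumes "f summable_on A" "g summable_on B" "\<And>x. f x \<ge> 0" "\<And>y. g y \<ge> 0"
  shows "(\<lambda>(x, y). f x * g y) summable_on (A \<times> B)"
proof (rule summable_on_SigmaI[where g = "\<lambda>x. f x * infsum g B"])
  fix x assume "x \<in> A"
  show "((\<lambda>y. case (x, y) of (x, y) \<Rightarrow> f x * g y) has_sum (f x * infsum g B)) B"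
    using assms(2) by (simp add: has_sum_cmult_right)
next
  show "(\<lambda>x. f x * infsum g B) summable_on A"
    using assms(1) by (rule summable_on_cmult_left)
qed (use assms in auto)

lemma summable_on_UNIV_nat:
  fixes f :: "nat \<Rightarrow> real"
  assumes "summable f" "\<And>n. f n \<ge> 0"
  shows "f summable_on UNIV"
  using assms by (intro norm_summable_imp_summable_on) simp

section \<open>Sums over tuples, one level at a time\<close>

lemma tuples_0: "tuples 0 = {\<lambda>_. undefined}"
  by (simp add: tuples_def)

text \<open>Splits off the outermost level for inductions on \<open>k\<close>. Restricting to
  \<open>{1..k}\<close> restores \<open>undefined\<close> at \<open>Suc k\<close>, which makes the
  correspondence bijective.\<close>

lemma tuples_Suc_has_sum_iff:
  "(g has_sum s) (tuples (Suc k) \<times> tuples (Suc k)) \<longleftrightarrow>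
   ((\<lambda>((a, b), (m, n)). g (m(Suc k := a), n(Suc k := b))) has_sum s) (UNIV \<times> (tuples k \<times> tuples k))"
proof -
  define R :: "(nat \<Rightarrow> nat) \<Rightarrow> nat \<Rightarrow> nat" where "R = (\<lambda>f. restrict f {1..k})"
  have upd: "(R f)(Suc k := f (Suc k)) = f" if "f \<in> tuples (Suc k)" for f
    using that by (auto simp: R_def tuples_def PiE_iff extensional_def fun_eq_iff)
  have res: "R f \<in> tuples k" for f
    by (simp add: R_def tuples_def)
  have res_upd: "R (f(Suc k := a)) = f" if "f \<in> tuples k" for f a
    using that by (auto simp: R_def tuples_def PiE_iff extensional_def fun_eq_iff)
  have upd_in: "f(Suc k := a) \<in> tuples (Suc k)" if "f \<in> tuples k" for f a
    using that by (auto simp: tuples_def PiE_iff extensional_def)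
  have "bij_betw (\<lambda>((a, b), (m, n)). (m(Suc k := a), n(Suc k := b)))
      (UNIV \<times> (tuples k \<times> tuples k)) (tuples (Suc k) \<times> tuples (Suc k))"
    by (rule bij_betwI[where g = "\<lambda>(m, n). ((m (Suc k), n (Suc k)), (R m, R n))"])
      (auto simp: upd res res_upd upd_in)
  from has_sum_reindex_bij_betw[OF this, of g s] show ?thesis
    by (simp add: case_prod_unfold)
qed

lemma summable_on_tuples_prod:
  fixes b :: "nat \<Rightarrow> nat \<times> nat \<Rightarrow> real"
  assumes "\<And>i. b i summable_on UNIV" "\<And>i x. b i x \<ge> 0"
  shows "(\<lambda>(m, n). \<Prod>i=1..k. b i (m i, n i)) summable_on (tuples k \<times> tuples k)"
proof (induction k)
  case 0
  show ?case by (simp add: tuples_0)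
next
  case (Suc k)
  have "(\<lambda>(x, u). b (Suc k) x * (case u of (m, n) \<Rightarrow> \<Prod>i=1..k. b i (m i, n i))) summable_on (UNIV \<times> (tuples k \<times> tuples k))"
    by (intro summable_on_product_real assms Suc.IH) (auto intro!: prod_nonneg assms)
  also have "(\<lambda>(x, u). b (Suc k) x * (case u of (m, n) \<Rightarrow> \<Prod>i=1..k. b i (m i, n i))) =
      (\<lambda>((x, y), (m, n)). case (m(Suc k := x), n(Suc k := y)) of (m, n) \<Rightarrow> \<Prod>i=1..Suc k. b i (m i, n i))"
  proof (rule ext)
    have "(\<Prod>i=1..k. b i ((m(Suc k := x)) i, (n(Suc k := y)) i)) = (\<Prod>i=1..k. b i (m i, n i))" for m n x y
      by (intro prod.cong) auto
    thus "(\<lambda>(x, u). b (Suc k) x * (case u of (m, n) \<Rightarrow> \<Prod>i=1..k. b i (m i, n i))) z =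
      (\<lambda>((x, y), (m, n)). case (m(Suc k := x), n(Suc k := y)) of (m, n) \<Rightarrow> \<Prod>i=1..Suc k. b i (m i, n i)) z" for z
      by (simp add: case_prod_unfold mult.commute)
  qed
  finally show ?case
    unfolding summable_on_def tuples_Suc_has_sum_iff by simp
qed

section \<open>The limit of large \<open>m\<close>, and the sum over the outermost level\<close>

context q_nome begin

text \<open>The limit is the same for all \<open>j\<close>, so in the limit the theta series factors
  out of \<open>theta_ker m 0\<close>.\<close>

lemma ker_0_tendsto: "(\<lambda>m. ker j m 0) \<longlonglongrightarrow> 1 / (qpoch_inf q q * qpoch_inf (- q) q)"
proof -
  have lim: "qpoch A q \<longlonglongrightarrow> qpoch_inf A q" for A by (rule qpoch_tendsto[OF norm_q])
  \<comment> \<open>The shift by \<open>j\<close> keeps the argument \<open>m - j\<close>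
    nonnegative, where \<open>sgn_poch\<close> is an ordinary \<open>qpoch\<close>.\<close>
  have "(\<lambda>m. ker j (m + j) 0) \<longlonglongrightarrow>
        qpoch_inf (- q) q * 1 / (qpoch_inf q q * qpoch_inf (- q) q * qpoch_inf (- q) q)"
  proof (rule Lim_transform_eventually)
    show "(\<lambda>m. qpoch (- q) q (m + j) * 1 / (qpoch q q (m + j) * qpoch (- q) q m * qpoch (- q) q (m + (j + j)))) \<longlonglongrightarrow>
       qpoch_inf (- q) q * 1 / (qpoch_inf q q * qpoch_inf (- q) q * qpoch_inf (- q) q)"
      using qpoch_inf_nz[OF norm_q] by (intro tendsto_intros LIMSEQ_ignore_initial_segment lim) auto
    have "nat (int (m + j) - int j) = m" "nat (int (m + j) + int j) = m + (j + j)"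
       "nat (int (m + j) - int 0) = m + j" for m
      by auto
    thus "\<forall>\<^sub>F m in sequentially. qpoch (- q) q (m + j) * 1 / (qpoch q q (m + j) * qpoch (- q) q m * qpoch (- q) q (m + (j + j))) =
      ker j (m + j) 0"
      by (intro always_eventually) (simp add: ker_def sgn_poch_def)
  qed
  hence "(\<lambda>m. ker j m 0) \<longlonglongrightarrow>
        qpoch_inf (- q) q * 1 / (qpoch_inf q q * qpoch_inf (- q) q * qpoch_inf (- q) q)"
    by (rule LIMSEQ_offset)
  thus ?thesis using qpoch_inf_nz[OF norm_q] by (simp add: mult_ac)
qed

lemma inverse_sgn_poch_le:
  obtains B where "B > 0"
    "\<And>z j. z \<ge> - int j \<Longrightarrow> norm (inverse (sgn_poch z)) * norm q ^ (\<Sum>i<j. i) \<le> B"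
proof -
  obtain B where B: "B > 0" "\<And>n. norm (inverse (qpoch (- q) q n)) \<le> B"
    using inverse_qpoch_bounded[OF norm_q, of "- q"] by blast
  define E where "E = exp (1 / (1 - norm q))"
  have "norm (inverse (sgn_poch z)) * norm q ^ (\<Sum>i<j. i) \<le> max B E" if "z \<ge> - int j" for z j
  proof (cases "z \<ge> 0")
    case True
    have "norm (inverse (sgn_poch z)) * norm q ^ (\<Sum>i<j. i) \<le> B * 1"
      using True B norm_q by (intro mult_mono power_le_one) (auto simp: sgn_poch_def)
    thus ?thesis by simp
  next
    case False
    define p where "p = nat (- z)"
    have p: "z = - int p" "p \<le> j" using False that by (auto simp: p_def)
    have "norm (inverse (sgn_poch z)) * norm q ^ (\<Sum>i<j. i) \<le> norm (inverse (sgn_poch z)) * norm q ^ (\<Sum>i<p. i)"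
      using p norm_q by (intro mult_left_mono power_decreasing sum_mono2) auto
    also have "\<dots> = norm (qpoch (- 1) q p)"
      unfolding inverse_sgn_poch_neg[symmetric] p by (simp add: norm_mult norm_power)
    also have "\<dots> \<le> E"
      unfolding E_def by (rule norm_qpoch_neg_one_le)
    finally show ?thesis by simp
  qed
  moreover have "max B E > 0" using B by simp
  ultimately show thesis using that by blast
qed

text \<open>Tannery's theorem needs a majorant uniform in \<open>m\<close> without the weight
  \<open>gauss\<close>, which \<open>theta_gauss_ker_le\<close> does not provide. The only large
  factor has order \<open>q^(-j(j-1)/2)\<close>, and the theta coefficient \<open>q^(j^2)\<close>
  absorbs it.\<close>

lemma theta_ker_0_le:
  obtains B where "B > 0" "\<And>j m. norm (theta_coeff q j * ker j m 0) \<le> B * norm q ^ j"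
proof -
  obtain B1 where B1: "B1 > 0" "\<And>n. norm (qpoch (- q) q n) \<le> B1"
    using qpoch_bounded[OF norm_q] by blast
  obtain B2 where B2: "B2 > 0" "\<And>n. norm (inverse (qpoch q q n)) \<le> B2"
    using inverse_qpoch_bounded[OF norm_q, of q] by blast
  obtain B3 where B3: "B3 > 0" "\<And>n. norm (inverse (qpoch (- q) q n)) \<le> B3"
    using inverse_qpoch_bounded[OF norm_q, of "- q"] by blast
  obtain B4 where B4: "B4 > 0"
    "\<And>z j. z \<ge> - int j \<Longrightarrow> norm (inverse (sgn_poch z)) * norm q ^ (\<Sum>i<j. i) \<le> B4"
    using inverse_sgn_poch_le by blast
  have "norm (theta_coeff q j * ker j m 0) \<le> 2 * (B1 * B2 * B3 * B4) * norm q ^ j" for j m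
  proof -
    let ?t = "\<Sum>i<j. i"
    have "ker j m 0 = qpoch (- q) q m * inverse (qpoch q q m) * inverse (qpoch (- q) q (m + j)) *
        inverse (sgn_poch (int m - int j))"
      by (simp add: ker_def sgn_poch_def divide_inverse nat_add_distrib)
    hence "norm (ker j m 0) * norm q ^ ?t = norm (qpoch (- q) q m) * norm (inverse (qpoch q q m)) *
        norm (inverse (qpoch (- q) q (m + j))) * (norm (inverse (sgn_poch (int m - int j))) * norm q ^ ?t)"
      by (simp only: norm_mult mult_ac)
    also have "\<dots> \<le> B1 * B2 * B3 * B4"
      using B1 B2 B3 B4 by (intro mult_mono mult_nonneg_nonneg) auto
    finally have k: "norm (ker j m 0) * norm q ^ ?t \<le> B1 * B2 * B3 * B4" .
    have "j + ?t \<le> j\<^sup>2"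
    proof (cases j)
      case (Suc i)
      have "j \<le> j * j" by (simp add: Suc)
      thus ?thesis using double_sum_lessThan[of j] unfolding power2_eq_square by linarith
    qed simp
    then obtain t where t: "j\<^sup>2 = ?t + (j + t)" by (metis add.commute add.left_commute le_Suc_ex)
    have "norm (theta_coeff q j * ker j m 0) \<le> 2 * norm q ^ j\<^sup>2 * norm (ker j m 0)"
      by (auto simp: theta_coeff_def norm_mult norm_power)
    also have "\<dots> = 2 * (norm (ker j m 0) * norm q ^ ?t) * norm q ^ (j + t)"
      unfolding t by (simp add: power_add mult_ac)
    also have "\<dots> \<le> 2 * (B1 * B2 * B3 * B4) * norm q ^ j"
      using norm_q B1 B2 B3 B4 by (intro mult_mono[OF mult_left_mono[OF k]] power_decreasing) auto
    finally show ?thesis .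
  qed
  thus thesis using that[of "2 * (B1 * B2 * B3 * B4)"] B1 B2 B3 B4 by simp
qed

text \<open>By \<open>theta_ker_eq\<close>, \<open>theta_ker m 0 * (qpoch q q m)\<^sup>2\<close>
  does not depend on \<open>m\<close>, so its value is its limit, and there Gauss' identity
  applies.\<close>

lemma theta_ker_0_0: "theta_ker 0 0 = (qpoch_inf q q / qpoch_inf (- q) q)\<^sup>2"
proof (rule LIMSEQ_unique)
  let ?P = "qpoch_inf q q" and ?Q = "qpoch_inf (- q) q"
  obtain B where B: "B > 0" "\<And>j m. norm (theta_coeff q j * ker j m 0) \<le> B * norm q ^ j"
    using theta_ker_0_le by blast
  have "(\<lambda>m. \<Sum>j. theta_coeff q j * ker j m 0) \<longlonglongrightarrow> (\<Sum>j. theta_coeff q j * (1 / (?P * ?Q)))"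
  proof (rule conjunct2[OF conjunct2[OF tannerys_theorem[where M = "\<lambda>j. B * norm q ^ j"]]])
    show "(\<lambda>m. theta_coeff q j * ker j m 0) \<longlonglongrightarrow> theta_coeff q j * (1 / (?P * ?Q))" for j
      by (intro tendsto_intros ker_0_tendsto)
    show "\<forall>\<^sub>F (j, m) in sequentially \<times>\<^sub>F sequentially. norm (theta_coeff q j * ker j m 0) \<le> B * norm q ^ j"
      using B by (intro always_eventually) auto
    show "summable (\<lambda>j. B * norm q ^ j)"
      using norm_q by (intro summable_mult summable_geometric) auto
  qed simp
  moreover have "(\<Sum>j. theta_coeff q j * (1 / (?P * ?Q))) = ?P / ?Q * (1 / (?P * ?Q))"
    using sums_mult2[OF gauss_theta_sums[OF norm_q]] sums_unique by metis
  ultimately have "(\<lambda>m. theta_ker m 0) \<longlonglongrightarrow> ?P / ?Q * (1 / (?P * ?Q))"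
    by (simp add: theta_ker_def)
  hence "(\<lambda>m. theta_ker m 0 * (qpoch q q m)\<^sup>2) \<longlonglongrightarrow> ?P / ?Q * (1 / (?P * ?Q)) * ?P\<^sup>2"
    by (intro tendsto_intros qpoch_tendsto[OF norm_q])
  moreover have "?P / ?Q * (1 / (?P * ?Q)) * ?P\<^sup>2 = (?P / ?Q)\<^sup>2"
    using qpoch_inf_nz[OF norm_q] by (simp add: power2_eq_square)
  moreover have "theta_ker m 0 * (qpoch q q m)\<^sup>2 = theta_ker 0 0" for m
    using theta_ker_eq[of m 0] qpoch_nz(1)[OF norm_q, of m] by simp
  ultimately show "(\<lambda>m. theta_ker 0 0) \<longlonglongrightarrow> (?P / ?Q)\<^sup>2" by simp
qed simp

lemma recip_poch_bounded:
  obtains B where "B \<ge> 1" "\<And>z. norm (recip_poch z) \<le> B"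
proof -
  obtain B where B: "B > 0" "\<And>n. norm (inverse (qpoch q q n)) \<le> B"
    using inverse_qpoch_bounded[OF norm_q, of q] by blast
  have "norm (recip_poch z) \<le> max 1 B" for z
    using B by (auto simp: recip_poch_def intro: order_trans[OF B(2)])
  thus thesis using that[of "max 1 B"] by simp
qed

lemma gauss_ker_bound:
  obtains h :: "nat \<times> nat \<Rightarrow> real" where "h summable_on UNIV" "\<And>x. h x \<ge> 0"
    "\<And>j m n. norm (theta_coeff q j * (gauss m n * ker j m n)) \<le> sqrt (norm q) ^ j * h (m, n)"
proof -
  obtain B where B: "B > 0" "\<And>j m n. norm (theta_coeff q j * (gauss m n * ker j m n)) \<le>
      B * sqrt (norm q) ^ j * sqrt (norm q) ^ n * growth m"
    using theta_gauss_ker_le by blast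
  have "(\<lambda>n. sqrt (norm q) ^ n) summable_on UNIV"
    using norm_q by (intro summable_on_UNIV_nat summable_geometric) auto
  hence "(\<lambda>(m, n). (B * growth m) * sqrt (norm q) ^ n) summable_on (UNIV \<times> UNIV)"
    using B growth_nonneg summable_growth norm_q
    by (intro summable_on_product_real summable_on_UNIV_nat summable_mult mult_nonneg_nonneg) auto
  moreover have "(\<lambda>(m, n). (B * growth m) * sqrt (norm q) ^ n) x \<ge> 0" for x
    using B growth_nonneg by (auto split: prod.splits)
  ultimately show thesis
    using B(2) by (intro that[of "\<lambda>(m, n). (B * growth m) * sqrt (norm q) ^ n"]) (auto simp: mult_ac)
qed

lemma theta_coeff_nz: "theta_coeff q j \<noteq> 0"
  by (simp add: theta_coeff_def)

lemma gauss_ker_summable: "(\<lambda>(m, n). norm (gauss m n * ker j m n)) summable_on UNIV"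
proof -
  obtain h :: "nat \<times> nat \<Rightarrow> real" where h: "h summable_on UNIV" "\<And>x. h x \<ge> 0"
    "\<And>j m n. norm (theta_coeff q j * (gauss m n * ker j m n)) \<le> sqrt (norm q) ^ j * h (m, n)"
    using gauss_ker_bound by blast
  have "(\<lambda>x. (sqrt (norm q) ^ j / norm (theta_coeff q j)) * h x) summable_on UNIV"
    using h by (intro summable_on_cmult_right)
  thus ?thesis
  proof (rule summable_on_comparison_test)
    fix x :: "nat \<times> nat"
    show "(case x of (m, n) \<Rightarrow> norm (gauss m n * ker j m n)) \<le> sqrt (norm q) ^ j / norm (theta_coeff q j) * h x"
      using h(3)[of j] theta_coeff_nz[of j]
      by (cases x) (simp add: norm_mult pos_le_divide_eq mult_ac)
  qed (auto split: prod.splits)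
qed

lemma gauss_summable: "(\<lambda>(m, n). norm (gauss m n)) summable_on UNIV"
proof -
  have "summable (\<lambda>n. norm q ^ n\<^sup>2)"
  proof (rule summable_comparison_test_ev)
    show "\<forall>\<^sub>F n in sequentially. norm (norm q ^ n\<^sup>2) \<le> norm q ^ n"
      using norm_q by (intro always_eventually allI)
        (auto simp: power2_eq_square intro!: power_decreasing)
    show "summable (\<lambda>n. norm q ^ n)" using norm_q by (intro summable_geometric) simp
  qed
  hence "(\<lambda>n. norm q ^ n\<^sup>2) summable_on UNIV"
    by (intro summable_on_UNIV_nat) auto
  hence "(\<lambda>(m, n). norm q ^ m\<^sup>2 * norm q ^ n\<^sup>2) summable_on (UNIV \<times> UNIV)"
    by (intro summable_on_product_real) auto
  hence "(\<lambda>(m, n). norm q ^ m\<^sup>2 * norm q ^ n\<^sup>2) summable_on UNIV" by simp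
  thus ?thesis
  proof (rule summable_on_comparison_test)
    fix x :: "nat \<times> nat"
    obtain m n where x: "x = (m, n)" by (cases x)
    have "norm (gauss m n) = norm q ^ (m\<^sup>2 + m * n + n\<^sup>2)"
      by (simp add: gauss_def norm_mult norm_power)
    also have "\<dots> \<le> norm q ^ (m\<^sup>2 + n\<^sup>2)" using norm_q by (intro power_decreasing) auto
    finally show "(case x of (m, n) \<Rightarrow> norm (gauss m n)) \<le> (case x of (m, n) \<Rightarrow> norm q ^ m\<^sup>2 * norm q ^ n\<^sup>2)"
      by (simp add: x power_add)
  qed (auto split: prod.splits)
qed

text \<open>The limit of \<open>ker_eigen\<close> at \<open>N = 0\<close> for large
  \<open>M\<close>. Each link \<open>recip_poch (int M - int m)\<close> tends to the reciprocal of
  \<open>?P\<close>, so the factor \<open>?P\<close> normalises its limit to 1.\<close>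

lemma gauss_ker_has_sum:
  "((\<lambda>(m, n). gauss m n * ker j m n * recip_poch (int n)) has_sum (q ^ j\<^sup>2 / qpoch_inf (- q) q)) UNIV"
proof -
  let ?P = "qpoch_inf q q" and ?Q = "qpoch_inf (- q) q"
  let ?f = "\<lambda>(m, n). gauss m n * ker j m n * recip_poch (int n)"
  obtain B where B: "B \<ge> 1" "\<And>z. norm (recip_poch z) \<le> B"
    using recip_poch_bounded by blast
  have "(\<lambda>x. (case x of (m, n) \<Rightarrow> norm (gauss m n * ker j m n)) * B) summable_on UNIV"
    by (intro summable_on_cmult_left gauss_ker_summable)
  hence abs: "(\<lambda>x. norm (?f x)) summable_on UNIV"
  proof (rule Infinite_Sum.abs_summable_on_comparison_test')
    fix x :: "nat \<times> nat"
    show "norm (?f x) \<le> (case x of (m, n) \<Rightarrow> norm (gauss m n * ker j m n)) * B"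
      using B by (cases x) (auto simp: norm_mult intro!: mult_left_mono)
  qed
  define S where "S = infsum ?f UNIV"
  have S: "(?f has_sum S) (UNIV \<times> UNIV)"
    unfolding S_def using abs by (simp add: abs_summable_summable)
  define F where "F = (\<lambda>m. \<Sum>n\<le>j. gauss m n * ker j m n * recip_poch (int n))"
  have inner: "((\<lambda>n. ?f (m, n)) has_sum F m) UNIV" for m
    by (rule has_sum_finite_neutralI[of "{..j}"]) (auto simp: F_def ker_eq_0)
  have "(F has_sum S) UNIV"
    by (rule has_sum_SigmaD[OF S inner])
  hence F: "F sums S" by (rule has_sum_imp_sums)
  \<comment> \<open>Absolute convergence in \<open>m\<close>, inherited from the double sum,
    supplies the majorant for Tannery's theorem.\<close>
  have "(\<lambda>x. norm (F x)) summable_on UNIV"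
  proof -
    have "(\<lambda>m. infsum (\<lambda>n. norm (?f (m, n))) UNIV) summable_on UNIV"
      using abs summable_on_Sigma_banach[of "\<lambda>m n. norm (?f (m, n))" UNIV "\<lambda>_. UNIV"]
      by (simp add: case_prod_unfold)
    thus ?thesis
    proof (rule summable_on_comparison_test)
      fix m
      have "((\<lambda>n. norm (?f (m, n))) has_sum (\<Sum>n\<le>j. norm (?f (m, n)))) UNIV"
        by (rule has_sum_finite_neutralI[of "{..j}"]) (auto simp: ker_eq_0)
      thus "norm (F m) \<le> infsum (\<lambda>n. norm (?f (m, n))) UNIV"
        unfolding F_def by (simp add: infsumI norm_sum)
    qed simp
  qed
  hence F_abs: "summable (\<lambda>m. norm (F m))"
    using has_sum_imp_sums summable_on_def sums_summable by blast
  have "(\<lambda>M. \<Sum>m. F m * (?P * recip_poch (int M - int m))) \<longlonglongrightarrow> (\<Sum>m. F m * 1)"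
  proof (rule conjunct2[OF conjunct2[OF tannerys_theorem[where M = "\<lambda>m. norm (F m) * (norm ?P * B)"]]])
    fix m
    have "(\<lambda>M. ?P * recip_poch (int (M + m) - int m)) \<longlonglongrightarrow> ?P * inverse ?P"
      using qpoch_inf_nz(1)[OF norm_q]
      by (intro tendsto_intros) (simp add: recip_poch_of_nat, intro tendsto_intros qpoch_tendsto[OF norm_q])
    hence "(\<lambda>M. ?P * recip_poch (int M - int m)) \<longlonglongrightarrow> ?P * inverse ?P"
      by (rule LIMSEQ_offset)
    hence "(\<lambda>M. ?P * recip_poch (int M - int m)) \<longlonglongrightarrow> 1"
      using qpoch_inf_nz(1)[OF norm_q] by simp
    thus "(\<lambda>M. F m * (?P * recip_poch (int M - int m))) \<longlonglongrightarrow> F m * 1"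
      by (intro tendsto_intros)
  next
    show "\<forall>\<^sub>F (m, M) in sequentially \<times>\<^sub>F sequentially.
        norm (F m * (?P * recip_poch (int M - int m))) \<le> norm (F m) * (norm ?P * B)"
      using B by (intro always_eventually) (auto simp: norm_mult intro!: mult_left_mono)
    show "summable (\<lambda>m. norm (F m) * (norm ?P * B))"
      by (intro summable_mult2 F_abs)
  qed simp
  moreover have "(\<Sum>m. F m * (?P * recip_poch (int M - int m))) = ?P * (q ^ j\<^sup>2 * ker j M 0)" for M
  proof -
    have "(\<Sum>m. F m * (?P * recip_poch (int M - int m))) = (\<Sum>m\<le>M. F m * (?P * recip_poch (int M - int m)))"
      by (rule suminf_finite) auto
    also have "\<dots> = ?P * transfer M j (\<lambda>m n. gauss m n * ker j m n) (int M) (int 0)"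
      unfolding transfer_def F_def by (simp add: sum_distrib_left sum_distrib_right mult_ac)
    finally show ?thesis by (simp only: ker_eigen[of M M 0 j])
  qed
  ultimately have "(\<lambda>M. ?P * (q ^ j\<^sup>2 * ker j M 0)) \<longlonglongrightarrow> S"
    using F by (simp add: sums_iff)
  moreover have "(\<lambda>M. ?P * (q ^ j\<^sup>2 * ker j M 0)) \<longlonglongrightarrow> ?P * (q ^ j\<^sup>2 * (1 / (?P * ?Q)))"
    by (intro tendsto_intros ker_0_tendsto)
  ultimately have "S = ?P * (q ^ j\<^sup>2 * (1 / (?P * ?Q)))"
    by (rule LIMSEQ_unique)
  hence "S = q ^ j\<^sup>2 / ?Q" using qpoch_inf_nz[OF norm_q] by simp
  with S show ?thesis by simp
qed

section \<open>Chains\<close>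

text \<open>Level 1 is innermost and feeds \<open>f\<close>; \<open>(M,N)\<close> is the end point
  beyond level \<open>k\<close>. Plain links \<open>recip_poch\<close> replace the
  \<open>q\<close>-binomials, so that adding a level is one application of the operator.\<close>

primrec chain :: "(nat \<Rightarrow> nat \<Rightarrow> complex) \<Rightarrow> nat \<Rightarrow> (nat \<Rightarrow> nat) \<Rightarrow> (nat \<Rightarrow> nat) \<Rightarrow> nat \<Rightarrow> nat \<Rightarrow> complex" where
  "chain f 0 m n M N = f M N"
| "chain f (Suc k) m n M N =
    gauss (m (Suc k)) (n (Suc k)) * chain f k m n (m (Suc k)) (n (Suc k)) *
    recip_poch (int M - int (m (Suc k))) * recip_poch (int (n (Suc k)) - int N)"

text \<open>The case \<open>N = 0\<close>, \<open>M = \<infinity>\<close>, up to the factor \<open>1 / (q;q)\<^sub>\<infinity>\<close>.\<close>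

definition closed_chain :: "(nat \<Rightarrow> nat \<Rightarrow> complex) \<Rightarrow> nat \<Rightarrow> (nat \<Rightarrow> nat) \<Rightarrow> (nat \<Rightarrow> nat) \<Rightarrow> complex" where
  "closed_chain f k m n = gauss (m (Suc k)) (n (Suc k)) * chain f k m n (m (Suc k)) (n (Suc k)) *
    recip_poch (int (n (Suc k)))"

lemma chain_cong:
  assumes "\<And>i. i \<in> {1..k} \<Longrightarrow> m i = m' i" "\<And>i. i \<in> {1..k} \<Longrightarrow> n i = n' i"
  shows "chain f k m n M N = chain f k m' n' M N"
  using assms by (induction k arbitrary: M N) simp_all

lemma chain_upd: "chain f k (m(Suc k := a)) (n(Suc k := b)) M N = chain f k m n M N"
  by (rule chain_cong) auto

lemma chain_factor:
  "chain f k m n M N = f (if k = 0 then M else m 1) (if k = 0 then N else n 1) * chain (\<lambda>_ _. 1) k m n M N"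
  by (induction k arbitrary: M N) auto

text \<open>A closed chain always has a level 1, so \<open>f\<close> is a plain factor and a series
  for \<open>f\<close> can be summed term by term.\<close>

lemma closed_chain_factor: "closed_chain f k m n = f (m 1) (n 1) * closed_chain (\<lambda>_ _. 1) k m n"
  unfolding closed_chain_def by (subst chain_factor) (simp add: mult_ac)

text \<open>Each of the \<open>2 * k\<close> links costs a factor \<open>B\<close>. The first weight
  stays together with \<open>f\<close>, because it has to tame the growth of
  \<open>ker\<close>.\<close>

lemma chain_le:
  assumes B: "B \<ge> 1" "\<And>z. norm (recip_poch z) \<le> B"
  shows "norm (gauss (m (Suc k)) (n (Suc k)) * chain f k m n (m (Suc k)) (n (Suc k))) \<le>
    B ^ (2 * k) * (norm (gauss (m 1) (n 1) * f (m 1) (n 1)) * (\<Prod>i=2..Suc k. norm (gauss (m i) (n i))))"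
proof (induction k)
  case (Suc k)
  let ?g = "gauss (m (Suc (Suc k))) (n (Suc (Suc k)))"
  let ?c = "gauss (m (Suc k)) (n (Suc k)) * chain f k m n (m (Suc k)) (n (Suc k))"
  let ?b = "norm (gauss (m 1) (n 1) * f (m 1) (n 1))"
  have "norm (?g * chain f (Suc k) m n (m (Suc (Suc k))) (n (Suc (Suc k)))) =
    norm ?c * norm ?g * (norm (recip_poch (int (m (Suc (Suc k))) - int (m (Suc k)))) *
    norm (recip_poch (int (n (Suc k)) - int (n (Suc (Suc k))))))"
    by (simp add: norm_mult mult_ac)
  also have "\<dots> \<le> (B ^ (2 * k) * (?b * (\<Prod>i=2..Suc k. norm (gauss (m i) (n i))))) * norm ?g * (B * B)"
    using B by (intro mult_mono[OF mult_right_mono[OF Suc.IH]] mult_mono mult_nonneg_nonneg)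
      (auto intro!: prod_nonneg mult_nonneg_nonneg)
  also have "\<dots> = B ^ (2 * Suc k) * (?b * (\<Prod>i=2..Suc (Suc k). norm (gauss (m i) (n i))))"
    by (simp add: mult_ac)
  finally show ?case .
qed simp

lemma summable_on_tuples_gauss:
  assumes "h summable_on UNIV" "\<And>x :: nat \<times> nat. h x \<ge> (0 :: real)"
  shows "(\<lambda>(m, n). h (m 1, n 1) * (\<Prod>i=2..Suc k. norm (gauss (m i) (n i)))) summable_on
         (tuples (Suc k) \<times> tuples (Suc k))"
proof -
  define b where "b = (\<lambda>i x. if i = (1 :: nat) then h x else (case x of (a, c) \<Rightarrow> norm (gauss a c)))"
  have "(\<lambda>(m, n). \<Prod>i=1..Suc k. b i (m i, n i)) summable_on (tuples (Suc k) \<times> tuples (Suc k))"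
  proof (rule summable_on_tuples_prod)
    show "b i summable_on UNIV" for i
      using assms gauss_summable by (cases "i = 1") (simp_all add: b_def)
    show "b i x \<ge> 0" for i x
      using assms by (simp add: b_def split: prod.splits)
  qed
  moreover have "(\<Prod>i=1..Suc k. b i (m i, n i)) = h (m 1, n 1) * (\<Prod>i=2..Suc k. norm (gauss (m i) (n i)))" for m n
  proof -
    have "(\<Prod>i=1..Suc k. b i (m i, n i)) = b 1 (m 1, n 1) * (\<Prod>i=2..Suc k. b i (m i, n i))"
      by (subst prod.atLeast_Suc_atMost) (simp_all add: numeral_2_eq_2)
    also have "(\<Prod>i=2..Suc k. b i (m i, n i)) = (\<Prod>i=2..Suc k. norm (gauss (m i) (n i)))"
      by (intro prod.cong) (auto simp: b_def)
    finally show ?thesis by (simp add: b_def)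
  qed
  ultimately show ?thesis by simp
qed

lemma chain_ker_summable:
  assumes "\<And>m n. norm (e m n) \<le> C"
  shows "(\<lambda>(m, n). gauss (m (Suc k)) (n (Suc k)) * chain (ker j) k m n (m (Suc k)) (n (Suc k)) *
            e (m (Suc k)) (n (Suc k))) summable_on (tuples (Suc k) \<times> tuples (Suc k))"
proof -
  obtain B where B: "B \<ge> 1" "\<And>z. norm (recip_poch z) \<le> B"
    using recip_poch_bounded by blast
  let ?h = "\<lambda>(m, n). norm (gauss m n * ker j m n)"
  have "(\<lambda>x. (B ^ (2 * k) * C) * (case x of (m, n) \<Rightarrow> ?h (m 1, n 1) * (\<Prod>i=2..Suc k. norm (gauss (m i) (n i)))))
      summable_on (tuples (Suc k) \<times> tuples (Suc k))"
    by (intro summable_on_cmult_right summable_on_tuples_gauss gauss_ker_summable) auto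
  hence "(\<lambda>x. norm (case x of (m, n) \<Rightarrow> gauss (m (Suc k)) (n (Suc k)) * chain (ker j) k m n (m (Suc k)) (n (Suc k)) *
            e (m (Suc k)) (n (Suc k)))) summable_on (tuples (Suc k) \<times> tuples (Suc k))"
  proof (rule Infinite_Sum.abs_summable_on_comparison_test')
    fix x :: "(nat \<Rightarrow> nat) \<times> (nat \<Rightarrow> nat)"
    obtain m n where x: "x = (m, n)" by (cases x)
    have C: "C \<ge> 0" using order_trans[OF norm_ge_zero assms] .
    have "norm (gauss (m (Suc k)) (n (Suc k)) * chain (ker j) k m n (m (Suc k)) (n (Suc k)) *
            e (m (Suc k)) (n (Suc k))) \<le>
      (B ^ (2 * k) * (norm (gauss (m 1) (n 1) * ker j (m 1) (n 1)) * (\<Prod>i=2..Suc k. norm (gauss (m i) (n i))))) * C"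
      unfolding norm_mult[of _ "e _ _"] using B C
      by (intro mult_mono[OF chain_le[OF B] assms] mult_nonneg_nonneg)
        (auto intro!: prod_nonneg mult_nonneg_nonneg)
    thus "norm (case x of (m, n) \<Rightarrow> gauss (m (Suc k)) (n (Suc k)) * chain (ker j) k m n (m (Suc k)) (n (Suc k)) *
            e (m (Suc k)) (n (Suc k))) \<le>
      (B ^ (2 * k) * C) * (case x of (m, n) \<Rightarrow> ?h (m 1, n 1) * (\<Prod>i=2..Suc k. norm (gauss (m i) (n i))))"
      by (simp add: x mult_ac)
  qed
  thus ?thesis by (rule abs_summable_summable)
qed

text \<open>\<open>e\<close> stands for whatever follows the last level: the two links to
  \<open>(M,N)\<close>, or the one link closing the chain. Summing the inner levels first leaves
  \<open>c\<close> times the kernel, so a single level against \<open>e\<close> remains.\<close>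

lemma chain_ker_extend:
  assumes IH: "\<And>M N. ((\<lambda>(m, n). chain (ker j) k m n M N) has_sum (c * ker j M N)) (tuples k \<times> tuples k)"
    and e: "\<And>m n. norm (e m n) \<le> C"
    and outer: "((\<lambda>(m, n). gauss m n * ker j m n * e m n) has_sum s) UNIV"
  shows "((\<lambda>(m, n). gauss (m (Suc k)) (n (Suc k)) * chain (ker j) k m n (m (Suc k)) (n (Suc k)) *
            e (m (Suc k)) (n (Suc k))) has_sum (c * s)) (tuples (Suc k) \<times> tuples (Suc k))"
proof -
  let ?F = "\<lambda>((a, b), (m, n)). gauss a b * chain (ker j) k m n a b * e a b"
  have eq: "(\<lambda>((a, b), (m, n)). case (m(Suc k := a), n(Suc k := b)) of (m, n) \<Rightarrow>
      gauss (m (Suc k)) (n (Suc k)) * chain (ker j) k m n (m (Suc k)) (n (Suc k)) *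
            e (m (Suc k)) (n (Suc k))) = ?F"
    by (auto simp: fun_eq_iff chain_upd)
  have sm: "?F summable_on (UNIV \<times> (tuples k \<times> tuples k))"
    using chain_ker_summable[where e = e, OF e, of k j]
    unfolding summable_on_def tuples_Suc_has_sum_iff eq .
  have inner: "((\<lambda>u. ?F (x, u)) has_sum (case x of (a, b) \<Rightarrow> c * (gauss a b * ker j a b * e a b)))
      (tuples k \<times> tuples k)" for x
  proof -
    obtain a b where x: "x = (a, b)" by (cases x)
    have "((\<lambda>u. gauss a b * e a b * (case u of (m, n) \<Rightarrow> chain (ker j) k m n a b)) has_sum
        (gauss a b * e a b * (c * ker j a b))) (tuples k \<times> tuples k)"
      by (intro has_sum_cmult_right IH)
    thus ?thesis by (simp add: x case_prod_unfold mult_ac)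
  qed
  have "((\<lambda>x. case x of (a, b) \<Rightarrow> c * (gauss a b * ker j a b * e a b)) has_sum (c * s)) UNIV"
    using has_sum_cmult_right[OF outer, of c] by (simp add: case_prod_unfold)
  from has_sum_SigmaI[OF inner this sm]
  have "(?F has_sum (c * s)) (UNIV \<times> (tuples k \<times> tuples k))" .
  thus ?thesis
    unfolding tuples_Suc_has_sum_iff eq .
qed

lemma chain_ker_has_sum:
  "((\<lambda>(m, n). chain (ker j) k m n M N) has_sum ((q ^ j\<^sup>2) ^ k * ker j M N)) (tuples k \<times> tuples k)"
proof (induction k arbitrary: M N)
  case 0
  show ?case by (rule has_sum_finiteI) (simp_all add: tuples_0)
next
  case (Suc k)
  obtain B where B: "B \<ge> 1" "\<And>z. norm (recip_poch z) \<le> B"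
    using recip_poch_bounded by blast
  let ?e = "\<lambda>m n. recip_poch (int M - int m) * recip_poch (int n - int N)"
  have e: "norm (?e m n) \<le> B * B" for m n
    unfolding norm_mult using B by (intro mult_mono) auto
  have "((\<lambda>(m, n). gauss m n * ker j m n * ?e m n) has_sum (q ^ j\<^sup>2 * ker j M N)) UNIV"
  proof (rule has_sum_finite_neutralI[of "{..M} \<times> {..j}"])
    show "q ^ j\<^sup>2 * ker j M N = (\<Sum>(m, n)\<in>{..M} \<times> {..j}. gauss m n * ker j m n * ?e m n)"
    proof (cases "N \<le> j")
      case True
      show ?thesis
        unfolding ker_eigen[OF order_refl True, symmetric] transfer_def sum.cartesian_product
        by (simp add: mult_ac)
    next
      case False
      thus ?thesis
        by (intro trans[OF _ sum.neutral[symmetric]]) (auto simp: ker_eq_0)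
    qed
  next
    have "recip_poch (int M - int a) = 0" if "\<not> a \<le> M" for a
      using that by simp
    moreover have "ker j a b = 0" if "\<not> b \<le> j" for a b
      using that by (simp add: ker_eq_0)
    ultimately show "(case x of (m, n) \<Rightarrow> gauss m n * ker j m n * ?e m n) = 0"
      if "x \<in> UNIV - {..M} \<times> {..j}" for x
      using that by (cases x) auto
  qed auto
  from chain_ker_extend[OF Suc.IH e this] show ?case
    by (simp add: mult_ac)
qed

lemma closed_chain_ker_has_sum:
  "((\<lambda>(m, n). closed_chain (ker j) k m n) has_sum ((q ^ j\<^sup>2) ^ Suc k / qpoch_inf (- q) q))
     (tuples (Suc k) \<times> tuples (Suc k))"
proof -
  obtain B where B: "B \<ge> 1" "\<And>z. norm (recip_poch z) \<le> B"
    using recip_poch_bounded by blast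
  from chain_ker_extend[OF chain_ker_has_sum, of "\<lambda>m n. recip_poch (int n)", OF B(2) gauss_ker_has_sum]
  show ?thesis by (simp add: closed_chain_def mult_ac)
qed

lemma theta_coeff_power: "theta_coeff q j * (q ^ j\<^sup>2) ^ k = theta_coeff (q ^ Suc k) j"
proof -
  have "q ^ j\<^sup>2 * (q ^ j\<^sup>2) ^ k = (q ^ Suc k) ^ j\<^sup>2"
    by (metis power_Suc power_commutes power_mult mult.commute)
  thus ?thesis by (simp add: theta_coeff_def)
qed

text \<open>The double sum over \<open>j\<close> and the tuples is evaluated in both orders. With
  the tuples first, each of the \<open>k + 1\<close> levels contributes \<open>q^(j^2)\<close> and
  the theta coefficient one more, which gives the theta series in
  \<open>p = q^(k+2)\<close>.\<close>

lemma closed_chain_theta_ker_has_sum: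
  fixes k :: nat
  defines "p \<equiv> q ^ (Suc k + 1)"
  shows "((\<lambda>(m, n). closed_chain theta_ker k m n) has_sum
     (qpoch_inf p p / qpoch_inf (- p) p / qpoch_inf (- q) q)) (tuples (Suc k) \<times> tuples (Suc k))"
proof -
  let ?T = "tuples (Suc k) \<times> tuples (Suc k)"
  let ?f = "\<lambda>(j, u). theta_coeff q j * (case u of (m, n) \<Rightarrow> closed_chain (ker j) k m n)"
  obtain B where B: "B \<ge> 1" "\<And>z. norm (recip_poch z) \<le> B"
    using recip_poch_bounded by blast
  obtain h :: "nat \<times> nat \<Rightarrow> real" where h: "h summable_on UNIV" "\<And>x. h x \<ge> 0"
    "\<And>j m n. norm (theta_coeff q j * (gauss m n * ker j m n)) \<le> sqrt (norm q) ^ j * h (m, n)"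
    using gauss_ker_bound by blast
  \<comment> \<open>The exponent of \<open>B\<close> counts the \<open>2 * k\<close> links between
    levels and the closing one.\<close>
  let ?w = "\<lambda>u. B ^ Suc (2 * k) * (case u of (m, n) \<Rightarrow> h (m 1, n 1) * (\<Prod>i=2..Suc k. norm (gauss (m i) (n i))))"
  have "(\<lambda>j. sqrt (norm q) ^ j) summable_on UNIV"
    using norm_q by (intro summable_on_UNIV_nat summable_geometric) auto
  moreover have "?w summable_on ?T"
    by (intro summable_on_cmult_right summable_on_tuples_gauss h)
  ultimately have "(\<lambda>(j, u). sqrt (norm q) ^ j * ?w u) summable_on (UNIV \<times> ?T)"
    using B h(2) by (intro summable_on_product_real) (auto intro!: mult_nonneg_nonneg prod_nonneg split: prod.splits)
  hence "(\<lambda>x. norm (?f x)) summable_on (UNIV \<times> ?T)"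
  proof (rule Infinite_Sum.abs_summable_on_comparison_test')
    fix x :: "nat \<times> (nat \<Rightarrow> nat) \<times> (nat \<Rightarrow> nat)"
    obtain j m n where x: "x = (j, m, n)" by (metis surj_pair)
    let ?p = "\<Prod>i=2..Suc k. norm (gauss (m i) (n i))"
    have "norm (closed_chain (ker j) k m n) \<le>
      B ^ (2 * k) * (norm (gauss (m 1) (n 1) * ker j (m 1) (n 1)) * ?p) * B"
      unfolding closed_chain_def norm_mult[of _ "recip_poch _"] using B
      by (intro mult_mono[OF chain_le[OF B] B(2)] mult_nonneg_nonneg) (auto intro!: prod_nonneg mult_nonneg_nonneg)
    hence "norm (theta_coeff q j) * norm (closed_chain (ker j) k m n) \<le>
      norm (theta_coeff q j) * (B ^ (2 * k) * (norm (gauss (m 1) (n 1) * ker j (m 1) (n 1)) * ?p) * B)"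
      by (intro mult_left_mono) auto
    also have "\<dots> = (B ^ Suc (2 * k) * ?p) * norm (theta_coeff q j * (gauss (m 1) (n 1) * ker j (m 1) (n 1)))"
      by (simp add: norm_mult mult_ac)
    also have "\<dots> \<le> (B ^ Suc (2 * k) * ?p) * (sqrt (norm q) ^ j * h (m 1, n 1))"
      using B by (intro mult_left_mono h(3) mult_nonneg_nonneg) (auto intro!: prod_nonneg mult_nonneg_nonneg)
    finally show "norm (?f x) \<le> (case x of (j, u) \<Rightarrow> sqrt (norm q) ^ j * ?w u)"
      by (simp add: x norm_mult mult_ac)
  qed
  hence sm: "?f summable_on (UNIV \<times> ?T)" by (rule abs_summable_summable)
  have eq: "theta_coeff q j * ((q ^ j\<^sup>2) ^ Suc k / qpoch_inf (- q) q) = theta_coeff p j / qpoch_inf (- q) q" for j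
    using theta_coeff_power[of j "Suc k"] by (simp add: p_def)
  define S where "S = infsum ?f (UNIV \<times> ?T)"
  have S: "(?f has_sum S) (UNIV \<times> ?T)" using sm by (simp add: S_def)
  have "((\<lambda>u. ?f (j, u)) has_sum (theta_coeff q j * ((q ^ j\<^sup>2) ^ Suc k / qpoch_inf (- q) q))) ?T" for j
    using has_sum_cmult_right[OF closed_chain_ker_has_sum] by simp
  from has_sum_SigmaD[OF S this]
  have "((\<lambda>j. theta_coeff q j * ((q ^ j\<^sup>2) ^ Suc k / qpoch_inf (- q) q)) has_sum S) UNIV" .
  hence "(\<lambda>j. theta_coeff q j * ((q ^ j\<^sup>2) ^ Suc k / qpoch_inf (- q) q)) sums S"
    by (rule has_sum_imp_sums)
  moreover have "(\<lambda>j. theta_coeff p j / qpoch_inf (- q) q) sums (qpoch_inf p p / qpoch_inf (- p) p / qpoch_inf (- q) q)"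
    unfolding p_def using norm_q
    by (intro sums_divide gauss_theta_sums) (simp add: norm_power power_less_one_iff del: power_Suc)
  ultimately have S_eq: "S = qpoch_inf p p / qpoch_inf (- p) p / qpoch_inf (- q) q"
    unfolding eq by (rule sums_unique2)
  have "((\<lambda>(u, j). ?f (j, u)) has_sum S) (?T \<times> UNIV)"
    using S by (subst (asm) has_sum_swap)
  moreover have "((\<lambda>j. (\<lambda>(u, j). ?f (j, u)) (u, j)) has_sum (case u of (m, n) \<Rightarrow> closed_chain theta_ker k m n)) UNIV" for u
  proof -
    obtain m n where u: "u = (m, n)" by (cases u)
    have "((\<lambda>j. theta_coeff q j * ker j (m 1) (n 1)) has_sum theta_ker (m 1) (n 1)) UNIV"
      by (rule norm_summable_imp_has_sum[OF summable_theta_ker theta_ker_sums])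
    from has_sum_cmult_left[OF this, of "closed_chain (\<lambda>_ _. 1) k m n"]
    show ?thesis
      unfolding u by (simp add: closed_chain_factor[of "ker _"] closed_chain_factor[of theta_ker] mult.assoc)
  qed
  ultimately have "((\<lambda>u. case u of (m, n) \<Rightarrow> closed_chain theta_ker k m n) has_sum S) ?T"
    by (rule has_sum_SigmaD)
  thus ?thesis by (simp add: S_eq)
qed

section \<open>Identifying the chain with the summand of the theorem\<close>

lemma qbinomial_eq: "qbinomial q N M = qpoch q q N / qpoch q q M * recip_poch (int N - int M)"
  by (auto simp: qbinomial_def recip_poch_def divide_inverse nat_diff_distrib mult_ac)

text \<open>Converting links into \<open>q\<close>-binomials leaves telescoping quotients: in
  \<open>m\<close> only \<open>qpoch q q (m 1) / qpoch q q (m (Suc k))\<close> survives, in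
  \<open>n\<close> the closing link cancels the last factor. The numerator later absorbs one of the
  two factors \<open>1 / qpoch q q (m 1)\<close> of \<open>theta_ker\<close>.\<close>

lemma closed_chain_one:
  "closed_chain (\<lambda>_ _. 1) k m n =
     (\<Prod>i=1..Suc k. gauss (m i) (n i)) * qpoch q q (m 1) / (qpoch q q (m (Suc k)) * qpoch q q (n 1)) *
     (\<Prod>i=2..Suc k. qbinomial q (m i) (m (i - 1))) * (\<Prod>i=2..Suc k. qbinomial q (n (i - 1)) (n i))"
proof (induction k)
  case 0
  show ?case using qpoch_nz(1)[OF norm_q] by (simp add: closed_chain_def recip_poch_of_nat divide_inverse)
next
  case (Suc k)
  let ?c = "closed_chain (\<lambda>_ _. 1) k m n"
  let ?m = "m (Suc k)" and ?m' = "m (Suc (Suc k))" and ?n = "n (Suc k)" and ?n' = "n (Suc (Suc k))"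
  have nz: "qpoch q q i \<noteq> 0" for i by (rule qpoch_nz(1)[OF norm_q])
  have "closed_chain (\<lambda>_ _. 1) (Suc k) m n =
    gauss ?m' ?n' * (?c * qpoch q q ?n) * recip_poch (int ?m' - int ?m) * recip_poch (int ?n - int ?n') / qpoch q q ?n'"
    using nz by (simp add: closed_chain_def recip_poch_of_nat divide_inverse mult_ac)
  also have "\<dots> = ?c * gauss ?m' ?n' * (qpoch q q ?m / qpoch q q ?m') *
     qbinomial q ?m' ?m * qbinomial q ?n ?n'"
    unfolding qbinomial_eq using nz by simp
  also have "\<dots> = (\<Prod>i=1..Suc (Suc k). gauss (m i) (n i)) * qpoch q q (m 1) / (qpoch q q ?m' * qpoch q q (n 1)) *
     (\<Prod>i=2..Suc (Suc k). qbinomial q (m i) (m (i - 1))) * (\<Prod>i=2..Suc (Suc k). qbinomial q (n (i - 1)) (n i))"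
    unfolding Suc.IH using nz by (simp add: mult_ac)
  finally show ?case .
qed

lemma prod_gauss:
  "(\<Prod>i\<in>A. gauss (m i) (n i)) = (- 1) ^ (\<Sum>i\<in>A. m i) * q ^ (\<Sum>i\<in>A. (m i)\<^sup>2 + m i * n i + (n i)\<^sup>2)"
  by (simp add: gauss_def prod.distrib power_sum)

text \<open>Extracting \<open>q^-i\<close> from each factor leaves \<open>(-1;q)_n\<close>; squaring
  doubles the extracted exponent to \<open>-n(n-1)\<close>.\<close>

lemma first_level:
  "(\<Prod>i<n. 1 + 1 / q ^ i)\<^sup>2 = q powi (- (int n)\<^sup>2 + int n) * (qpoch (- 1) q n)\<^sup>2"
proof -
  have "(\<Prod>i<n. 1 + 1 / q ^ i) * q ^ (\<Sum>i<n. i) = qpoch (- 1) q n"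
    using inverse_sgn_poch_neg[of n] by (cases "n = 0") (simp_all add: sgn_poch_def)
  hence "(qpoch (- 1) q n)\<^sup>2 = ((\<Prod>i<n. 1 + 1 / q ^ i) * q ^ (\<Sum>i<n. i))\<^sup>2"
    by (simp only:)
  hence "(qpoch (- 1) q n)\<^sup>2 = (\<Prod>i<n. 1 + 1 / q ^ i)\<^sup>2 * q ^ (2 * (\<Sum>i<n. i))"
    by (simp only: power_mult_distrib power_mult[symmetric] mult.commute[of 2])
  moreover have "q powi (- (int n)\<^sup>2 + int n) * q ^ (2 * (\<Sum>i<n. i)) = 1"
  proof -
    have "int (2 * (\<Sum>i<n. i)) = (int n)\<^sup>2 - int n"
      using double_sum_lessThan[of n] unfolding power2_eq_square by (metis add_diff_cancel_right' of_nat_add of_nat_mult)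
    hence "- (int n)\<^sup>2 + int n + int (2 * (\<Sum>i<n. i)) = 0" by simp
    hence "q powi (- (int n)\<^sup>2 + int n) * q powi int (2 * (\<Sum>i<n. i)) = 1"
      by (metis power_int_0_right power_int_add q_nz)
    thus ?thesis by (simp only: power_int_of_nat)
  qed
  ultimately show ?thesis by (simp add: mult_ac)
qed

end

definition summand :: "complex \<Rightarrow> nat \<Rightarrow> (nat \<Rightarrow> nat) \<Rightarrow> (nat \<Rightarrow> nat) \<Rightarrow> complex" where
  "summand q k m n =
        (-1) ^ (\<Sum>i=1..k. m i)
        * q powi (- (int (n 1))\<^sup>2 + int (n 1)
                  + (\<Sum>i=1..k. (int (m i))\<^sup>2 + int (m i) * int (n i) + (int (n i))\<^sup>2))
        * (qpoch (-1) q (n 1))\<^sup>2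
        / (qpoch q q (m k) * qpoch q q (m 1) * qpoch q q (n 1))
        * (\<Prod>i=2..k. qbinomial q (m i) (m (i - 1)))
        * (\<Prod>i=2..k. qbinomial q (n (i - 1)) (n i))"

lemma (in q_nome) closed_chain_theta_ker:
  "closed_chain theta_ker k m n =
     (qpoch_inf q q / qpoch_inf (- q) q)\<^sup>2 * summand q (Suc k) m n"
proof -
  let ?e = "\<Sum>i=1..Suc k. (m i)\<^sup>2 + m i * n i + (n i)\<^sup>2"
  have "(\<Sum>i=1..Suc k. (int (m i))\<^sup>2 + int (m i) * int (n i) + (int (n i))\<^sup>2) = int ?e"
    by simp
  hence "q powi (- (int (n 1))\<^sup>2 + int (n 1)
      + (\<Sum>i=1..Suc k. (int (m i))\<^sup>2 + int (m i) * int (n i) + (int (n i))\<^sup>2)) =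
      q powi (- (int (n 1))\<^sup>2 + int (n 1)) * q ^ ?e"
    by (simp only: power_int_add q_nz power_int_of_nat simp_thms)
  hence summand: "summand q (Suc k) m n = (- 1) ^ (\<Sum>i=1..Suc k. m i) *
      (q powi (- (int (n 1))\<^sup>2 + int (n 1)) * q ^ ?e) * (qpoch (-1) q (n 1))\<^sup>2
        / (qpoch q q (m (Suc k)) * qpoch q q (m 1) * qpoch q q (n 1))
        * (\<Prod>i=2..Suc k. qbinomial q (m i) (m (i - 1)))
        * (\<Prod>i=2..Suc k. qbinomial q (n (i - 1)) (n i))"
    unfolding summand_def by (simp only:)
  have nz: "qpoch q q i \<noteq> 0" for i by (rule qpoch_nz(1)[OF norm_q])
  have "T * (P * Q) / a\<^sup>2 * (s * e * a / (c * d) * u * v) = T * (s * (P * e) * Q / (c * a * d) * u * v)"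
    if "a \<noteq> 0" for T P Q a s e c d u v :: complex
    using that by (simp add: power2_eq_square mult_ac)
  thus ?thesis
    unfolding closed_chain_factor[of theta_ker] closed_chain_one theta_ker_eq[of "m 1" "n 1"] theta_ker_0_0
      first_level prod_gauss summand using nz by blast
qed

text \<open>The first level cancels \<open>-n_1^2\<close>, so the exponent of \<open>q\<close> is a
  sum of nonnegative terms that vanishes only at the zero tuples; every other summand is a positive
  power of 0.\<close>

lemma summand_has_sum_0:
  assumes "k \<ge> 1"
  shows "((\<lambda>(m, n). summand 0 k m n) has_sum 1) (tuples k \<times> tuples k)"
proof -
  define z :: "nat \<Rightarrow> nat" where "z = (\<lambda>i. if i \<in> {1..k} then 0 else undefined)"
  have z: "z \<in> tuples k" by (auto simp: z_def tuples_def)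
  show ?thesis
  proof (rule has_sum_finite_neutralI[of "{(z, z)}"])
    fix x assume x: "x \<in> tuples k \<times> tuples k - {(z, z)}"
    obtain m n where mn: "x = (m, n)" by (cases x)
    let ?t = "\<lambda>i. (int (m i))\<^sup>2 + int (m i) * int (n i) + (int (n i))\<^sup>2"
    let ?e = "- (int (n 1))\<^sup>2 + int (n 1) + (\<Sum>i=1..k. ?t i)"
    have split: "?e = int (n 1) + (int (m 1))\<^sup>2 + int (m 1) * int (n 1) + (\<Sum>i=Suc 1..k. ?t i)"
      using assms by (subst sum.atLeast_Suc_atMost) auto
    have nonneg: "(\<Sum>i=Suc 1..k. ?t i) \<ge> 0" by (intro sum_nonneg) auto
    have "?e \<noteq> 0"
    proof
      assume "?e = 0"
      hence *: "int (n 1) = 0" "(int (m 1))\<^sup>2 = 0" "(\<Sum>i=Suc 1..k. ?t i) = 0"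
        using nonneg unfolding split by (smt (verit) of_nat_0_le_iff zero_le_mult_iff zero_le_power2)+
      have "?t i = 0" if "i \<in> {Suc 1..k}" for i
        using *(3) that by (subst (asm) sum_nonneg_eq_0_iff) auto
      hence "m i = 0 \<and> n i = 0" if "i \<in> {Suc 1..k}" for i
        using that by (smt (verit) of_nat_0_le_iff of_nat_eq_0_iff zero_le_mult_iff zero_le_power2 power_eq_0_iff)
      moreover have "m 1 = 0" "n 1 = 0" using * by auto
      ultimately have "m i = 0 \<and> n i = 0" if "i \<in> {1..k}" for i
        using that by (cases "i = 1") auto
      hence "m = z" "n = z"
        using x mn by (auto simp: z_def tuples_def PiE_iff extensional_def fun_eq_iff)
      thus False using x mn by simp
    qed
    thus "(case x of (m, n) \<Rightarrow> summand 0 k m n) = 0"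
      by (simp add: mn summand_def power_int_0_left_if)
  next
    have "z i = 0" if "1 \<le> i" "i \<le> k" for i
      using that by (simp add: z_def)
    hence "(\<Prod>i=2..k. qbinomial 0 (z i) (z (i - 1))) = 1" "(\<Prod>i=2..k. qbinomial 0 (z (i - 1)) (z i)) = 1"
      by (auto intro!: prod.neutral simp: qbinomial_def)
    thus "1 = (\<Sum>(m, n)\<in>{(z, z)}. summand 0 k m n)"
      using assms by (simp add: summand_def) (simp add: z_def)
  qed (use z in auto)
qed

theorem theorem1p6:
  fixes q :: complex and k :: nat
  assumes "norm q < 1" and "k \<ge> 1"
  shows
    "((\<lambda>(m, n).
        (-1) ^ (\<Sum>i=1..k. m i)
        * q powi (- (int (n 1))\<^sup>2 + int (n 1)
                  + (\<Sum>i=1..k. (int (m i))\<^sup>2 + int (m i) * int (n i) + (int (n i))\<^sup>2))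
        * (qpoch (-1) q (n 1))\<^sup>2
        / (qpoch q q (m k) * qpoch q q (m 1) * qpoch q q (n 1))
        * (\<Prod>i=2..k. qbinomial q (m i) (m (i - 1)))
        * (\<Prod>i=2..k. qbinomial q (n (i - 1)) (n i)))
      has_sum
        (qpoch_inf (q ^ 2) (q ^ 2) * (qpoch_inf (q ^ (k + 1)) (q ^ (k + 1)))\<^sup>2
         / ((qpoch_inf q q) ^ 3 * qpoch_inf (q ^ (2 * k + 2)) (q ^ (2 * k + 2)))))
     (tuples k \<times> tuples k)"
proof -
  define p where "p = q ^ (k + 1)"
  let ?P = "qpoch_inf q q" and ?Q = "qpoch_inf (- q) q"
  have p: "norm p < 1" using assms by (simp add: p_def norm_power power_less_one_iff del: power_Suc)
  \<comment> \<open>Splitting \<open>(q^2;q^2)\<close> in base \<open>q\<close> and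
    \<open>(p^2;p^2)\<close> in base \<open>p\<close> cancels one factor \<open>?P\<close> and one
    factor \<open>qpoch_inf p p\<close>; the quotient left in base \<open>p\<close> is Gauss' value
    of the theta series.\<close>
  have rhs: "qpoch_inf (q ^ 2) (q ^ 2) * (qpoch_inf (q ^ (k + 1)) (q ^ (k + 1)))\<^sup>2
         / ((qpoch_inf q q) ^ 3 * qpoch_inf (q ^ (2 * k + 2)) (q ^ (2 * k + 2))) =
         (?Q / ?P\<^sup>2) * (qpoch_inf p p / qpoch_inf (- p) p)"
  proof -
    have "2 * k + 2 = (k + 1) * 2" by simp
    hence "q ^ (2 * k + 2) = p ^ 2" by (simp only: p_def power_mult)
    thus ?thesis
      unfolding p_def[symmetric] qpoch_inf_square_base[OF assms(1)]
      using qpoch_inf_nz[OF assms(1)] qpoch_inf_nz[OF p]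
      by (simp add: qpoch_inf_square_base[OF p]) (simp add: power2_eq_square power3_eq_cube)
  qed
  have "((\<lambda>(m, n). summand q k m n) has_sum ((?Q / ?P\<^sup>2) * (qpoch_inf p p / qpoch_inf (- p) p)))
      (tuples k \<times> tuples k)"
  proof (cases "q = 0")
    case True
    have "qpoch_inf 0 0 = 1" by (simp add: qpoch_inf_def)
    thus ?thesis using summand_has_sum_0[OF assms(2)] by (simp add: True p_def)
  next
    case False
    then interpret q_nome q using assms by unfold_locales
    obtain k' where k: "k = Suc k'" using assms by (cases k) auto
    \<comment> \<open>The inverse square is the constant of the first-level expansion; it turns
      \<open>closed_chain theta_ker\<close> into \<open>summand\<close>.\<close>
    have "((\<lambda>u. inverse ((?P / ?Q)\<^sup>2) * (case u of (m, n) \<Rightarrow> closed_chain theta_ker k' m n)) has_sum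
       (inverse ((?P / ?Q)\<^sup>2) * (qpoch_inf p p / qpoch_inf (- p) p / ?Q))) (tuples k \<times> tuples k)"
      unfolding k p_def by (intro has_sum_cmult_right closed_chain_theta_ker_has_sum)
    moreover have "inverse ((?P / ?Q)\<^sup>2) * (qpoch_inf p p / qpoch_inf (- p) p / ?Q) =
       (?Q / ?P\<^sup>2) * (qpoch_inf p p / qpoch_inf (- p) p)"
      using qpoch_inf_nz[OF assms(1)] by (simp add: power2_eq_square)
    moreover have "inverse ((?P / ?Q)\<^sup>2) * (case u of (m, n) \<Rightarrow> closed_chain theta_ker k' m n) =
        (case u of (m, n) \<Rightarrow> summand q k m n)" for u
      using qpoch_inf_nz[OF assms(1)] by (cases u) (simp add: closed_chain_theta_ker k)
    ultimately show ?thesis by simp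
  qed
  thus ?thesis unfolding rhs summand_def .
qed

end
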